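(* Every countable virtually nilpotent group is congruent monotileable.
   Context: Groups are discrete; $1_G$ denotes the unit of a group $G$. A group is virtually nilpotent if it has a nilpotent subgroup of finite index. A right Følner sequence of a countable group $G$ is a sequence $(F_n)_{n\ge 0}$ of nonempty finite subsets of $G$ such that $\lim_{n\to\infty}\frac{|F_n g\setminus F_n|}{|F_n|}=0$ for every $g\in G$. A left monotile of $G$ is a finite subset $F\subseteq G$ for which there is a subset $C\subseteq G$ such that $\{cF: c\in C\}$ is a partition of $G$. A sequence $(F_n)_{n\ge 0}$ of finite subsets of $G$ is congruent if $1_G\in F_0$ and for every $n\ge 0$ there is a set $J_n\subseteq G$ with $1_G\in J_n$ such that $\{cF_n: c\in J_n\}$ is a partition of $F_{n+1}$ (i.e. the sets $cF_n$, $c\in J_n$, are pairwise disjoint with union $F_{n+1}$). $G$ is congruent monotileable if it admits a congruent right Følner sequence $(F_n)_{n\ge0}$ all of whose members are left monotiles of $G$ and which is exhaustive, i.e. $G=\bigcup_{n\ge 0}F_n$. *)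

theory Defs
  imports
    Complex_Main
    "HOL-Algebra.Algebra"
    "HOL-Library.Countable_Set"
    "HOL-Library.Disjoint_Sets"
begin

definition commutator_subgroup ::
    "('a, 'b) monoid_scheme \<Rightarrow> 'a set \<Rightarrow> 'a set \<Rightarrow> 'a set"
  where "commutator_subgroup G H K =
    generate G (\<Union>h\<in>H. \<Union>k\<in>K. {h \<otimes>\<^bsub>G\<^esub> k \<otimes>\<^bsub>G\<^esub> inv\<^bsub>G\<^esub> h \<otimes>\<^bsub>G\<^esub> inv\<^bsub>G\<^esub> k})"

fun lower_central_series :: "('a, 'b) monoid_scheme \<Rightarrow> nat \<Rightarrow> 'a set"
  where
    "lower_central_series G 0 = carrier G"
  | "lower_central_series G (Suc n) =
       commutator_subgroup G (lower_central_series G n) (carrier G)"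

definition nilpotent_group :: "('a, 'b) monoid_scheme \<Rightarrow> bool"
  where "nilpotent_group G \<longleftrightarrow>
    group G \<and> (\<exists>n. lower_central_series G n = {\<one>\<^bsub>G\<^esub>})"

definition virtually_nilpotent :: "('a, 'b) monoid_scheme \<Rightarrow> bool"
  where "virtually_nilpotent G \<longleftrightarrow>
    (\<exists>H. subgroup H G \<and> finite (rcosets\<^bsub>G\<^esub> H) \<and> nilpotent_group (G\<lparr>carrier := H\<rparr>))"

definition right_Folner_sequence ::
    "('a, 'b) monoid_scheme \<Rightarrow> (nat \<Rightarrow> 'a set) \<Rightarrow> bool"
  where "right_Folner_sequence G F \<longleftrightarrow>
    (\<forall>n. F n \<noteq> {} \<and> finite (F n) \<and> F n \<subseteq> carrier G) \<and>
    (\<forall>g\<in>carrier G.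
      (\<lambda>n. real (card ((F n #>\<^bsub>G\<^esub> g) - F n)) / real (card (F n))) \<longlonglongrightarrow> 0)"

(* The partition is read as an indexed family: distinct centres in C give disjoint translates.
   Nonempty blocks are not demanded here: F is nonempty for a monotile because the carrier is,
   and in a congruent sequence because 1 lies in F 0 and in every J. *)
definition left_tiling ::
    "('a, 'b) monoid_scheme \<Rightarrow> 'a set \<Rightarrow> 'a set \<Rightarrow> 'a set \<Rightarrow> bool"
  where "left_tiling G C F A \<longleftrightarrow>
    C \<subseteq> carrier G \<and> disjoint_family_on (\<lambda>c. c <#\<^bsub>G\<^esub> F) C \<and> (\<Union>c\<in>C. c <#\<^bsub>G\<^esub> F) = A"

definition left_monotile :: "('a, 'b) monoid_scheme \<Rightarrow> 'a set \<Rightarrow> bool"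
  where "left_monotile G F \<longleftrightarrow>
    finite F \<and> F \<subseteq> carrier G \<and> (\<exists>C. left_tiling G C F (carrier G))"

definition congruent_sequence ::
    "('a, 'b) monoid_scheme \<Rightarrow> (nat \<Rightarrow> 'a set) \<Rightarrow> bool"
  where "congruent_sequence G F \<longleftrightarrow>
    (\<forall>n. finite (F n) \<and> F n \<subseteq> carrier G) \<and>
    \<one>\<^bsub>G\<^esub> \<in> F 0 \<and>
    (\<forall>n. \<exists>J. \<one>\<^bsub>G\<^esub> \<in> J \<and> left_tiling G J (F n) (F (Suc n)))"

definition congruent_monotileable :: "('a, 'b) monoid_scheme \<Rightarrow> bool"
  where "congruent_monotileable G \<longleftrightarrow>
    (\<exists>F. right_Folner_sequence G F \<and> congruent_sequence G F \<and>
         (\<forall>n. left_monotile G (F n)) \<and> (\<Union>n. F n) = carrier G)"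

end

theory Submission
  imports Defs
begin

text \<open>
  The proof produces finite sets that can be enlarged, by translates, to sets as large and as
  invariant as desired, and it moves this property up through group extensions. Following a
  Folner sequence through an extension is awkward, because the invariance demanded of the
  kernel part depends on the part chosen in the quotient. The property used here, a
  \<^emph>\<open>tile system\<close>, therefore has no index: it is a family of finite sets containing the unit in
  which every member \<open>A\<close> is enlarged to some member \<open>B\<close> that is tiled by translates of \<open>A\<close>, contains
  a prescribed finite set and is almost invariant under it to a prescribed precision. For a
  countable group, dependent choice along an enumeration turns a tile system into an exhaustive
  congruent Folner sequence. Its members are then monotiles for free: since the unit is among the
  centres at every stage, the centres of the tilings of \<open>F m\<close> by \<open>F n\<close> increase with \<open>m\<close>, and their
  union tiles the whole group (lemma \<open>exhaustive_congruent_imp_monotile\<close>).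

  Tile systems are built from sets of the form \<open>A S\<close>, where \<open>A\<close> lies in a subgroup and
  \<open>S\<close> represents distinct cosets. If \<open>J A = A'\<close> and \<open>I S = S'\<close> are tilings and \<open>I\<close> commutes with \<open>A\<close>,
  then \<open>(J I)(A S) = A' S'\<close> is again a tiling. Two cases suffice.
  For a subgroup \<open>H\<close> of finite index let \<open>S\<close> be a fixed right transversal and \<open>I\<close> trivial; with the
  subgroup part on the left, the centres act on \<open>A\<close> directly and never meet \<open>S\<close>
  (lemma \<open>extendable_tile_finite_index\<close>). For a central extension let \<open>S\<close> be a lift of a tile of the
  quotient (lemma \<open>extendable_tile_central_extension\<close>). In both cases \<open>s g = b s'\<close> for all but few
  \<open>s\<close> in \<open>S\<close>, with \<open>b\<close> from a finite set, so it is enough to choose \<open>A\<close>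
  almost invariant under that set \<^emph>\<open>after\<close> \<open>S\<close> has been chosen.

  Cyclic groups are handled by symmetric intervals. The central extension lemma keeps the given
  tile \<open>A\<close> of the kernel, so in an abelian group a tile of a finitely generated subgroup
  remains extendable when a generator is added; the tiles of all finitely generated subgroups
  together form a tile system for the abelian group. Nilpotent groups follow by induction along
  the lower central series, whose last nontrivial term is central, and finite index gives the theorem.
\<close>

section \<open>Tile systems\<close>

definition tiled_extension :: "('a, 'b) monoid_scheme \<Rightarrow> 'a set \<Rightarrow> 'a set \<Rightarrow> bool"
  where "tiled_extension G A B \<longleftrightarrow> (\<exists>J. \<one>\<^bsub>G\<^esub> \<in> J \<and> left_tiling G J A B)"

text \<open>
  The points of \<open>B\<close> that \<open>g\<close> moves out of \<open>B\<close> are counted before the translation; they are as many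
  as the elements of \<open>B g - B\<close> in the usual Folner quotient.
\<close>

definition almost_invariant ::
    "('a, 'b) monoid_scheme \<Rightarrow> 'a set \<Rightarrow> real \<Rightarrow> 'a set \<Rightarrow> bool"
  where "almost_invariant G K \<epsilon> B \<longleftrightarrow>
    (\<forall>g\<in>K. real (card {x \<in> B. x \<otimes>\<^bsub>G\<^esub> g \<notin> B}) \<le> \<epsilon> * real (card B))"

definition tile_system :: "('a, 'b) monoid_scheme \<Rightarrow> 'a set set \<Rightarrow> bool"
  where "tile_system G \<F> \<longleftrightarrow>
    (\<forall>A\<in>\<F>. finite A \<and> A \<subseteq> carrier G \<and> \<one>\<^bsub>G\<^esub> \<in> A) \<and>
    (\<forall>A\<in>\<F>. \<forall>K \<epsilon>. finite K \<longrightarrow> K \<subseteq> carrier G \<longrightarrow> \<epsilon> > 0 \<longrightarrow>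
      (\<exists>B\<in>\<F>. tiled_extension G A B \<and> K \<subseteq> B \<and> almost_invariant G K \<epsilon> B))"

text \<open>
  Tile systems are closed under unions, so the extendable tiles are the members of the largest
  tile system of the group: the property is coinductive.
\<close>

definition extendable_tile :: "('a, 'b) monoid_scheme \<Rightarrow> 'a set \<Rightarrow> bool"
  where "extendable_tile G A \<longleftrightarrow> (\<exists>\<F>. tile_system G \<F> \<and> A \<in> \<F>)"

lemma tile_systemD:
  assumes "tile_system G \<F>" "A \<in> \<F>"
  shows "finite A" "A \<subseteq> carrier G" "\<one>\<^bsub>G\<^esub> \<in> A"
  using assms by (auto simp: tile_system_def)

lemma tile_system_step:
  assumes "tile_system G \<F>" "A \<in> \<F>" "finite K" "K \<subseteq> carrier G" "\<epsilon> > 0"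
  obtains B where "B \<in> \<F>" "tiled_extension G A B" "K \<subseteq> B" "almost_invariant G K \<epsilon> B"
  using assms unfolding tile_system_def by meson

lemma tile_systemI:
  assumes "\<And>A. A \<in> \<F> \<Longrightarrow> finite A \<and> A \<subseteq> carrier G \<and> \<one>\<^bsub>G\<^esub> \<in> A"
    and "\<And>A K \<epsilon>. \<lbrakk>A \<in> \<F>; finite K; K \<subseteq> carrier G; \<epsilon> > 0\<rbrakk> \<Longrightarrow>
      \<exists>B\<in>\<F>. tiled_extension G A B \<and> K \<subseteq> B \<and> almost_invariant G K \<epsilon> B"
  shows "tile_system G \<F>"
  using assms unfolding tile_system_def by blast

lemma tile_system_Union:
  assumes "\<And>\<F>. \<F> \<in> \<SS> \<Longrightarrow> tile_system G \<F>"
  shows "tile_system G (\<Union>\<SS>)"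
proof (rule tile_systemI)
  fix A assume "A \<in> \<Union>\<SS>"
  then show "finite A \<and> A \<subseteq> carrier G \<and> \<one>\<^bsub>G\<^esub> \<in> A"
    using assms tile_systemD by (metis UnionE)
next
  fix A K and \<epsilon> :: real
  assume "A \<in> \<Union>\<SS>" "finite K" "K \<subseteq> carrier G" "\<epsilon> > 0"
  then show "\<exists>B\<in>\<Union>\<SS>. tiled_extension G A B \<and> K \<subseteq> B \<and> almost_invariant G K \<epsilon> B"
    using assms tile_system_step by (metis UnionE UnionI)
qed

lemma tile_system_extendable_tiles: "tile_system G {A. extendable_tile G A}"
proof -
  have "{A. extendable_tile G A} = \<Union>{\<F>. tile_system G \<F>}"
    by (auto simp: extendable_tile_def)
  then show ?thesis using tile_system_Union[of "{\<F>. tile_system G \<F>}" G] by simp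
qed

context group
begin

lemma left_tiling_iff_bij_betw:
  assumes "F \<subseteq> carrier G"
  shows "left_tiling G C F A \<longleftrightarrow>
    C \<subseteq> carrier G \<and> bij_betw (\<lambda>(c, x). c \<otimes> x) (C \<times> F) A"
proof -
  have "disjoint_family_on (\<lambda>c. c <# F) C \<longleftrightarrow> inj_on (\<lambda>(c, x). c \<otimes> x) (C \<times> F)"
    if C: "C \<subseteq> carrier G"
  proof
    assume d: "disjoint_family_on (\<lambda>c. c <# F) C"
    show "inj_on (\<lambda>(c, x). c \<otimes> x) (C \<times> F)"
    proof (clarsimp simp: inj_on_def)
      fix c x d y
      assume *: "c \<in> C" "x \<in> F" "d \<in> C" "y \<in> F" "c \<otimes> x = d \<otimes> y"
      then have "c \<otimes> x \<in> c <# F" "c \<otimes> x \<in> d <# F"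
        unfolding l_coset_def by blast+
      then have "c = d" using d * by (auto simp: disjoint_family_on_def)
      then show "c = d \<and> x = y" using * C assms by (metis l_cancel subset_eq)
    qed
  next
    assume i: "inj_on (\<lambda>(c, x). c \<otimes> x) (C \<times> F)"
    have "c = d" if "c \<in> C" "d \<in> C" "u \<in> c <# F" "u \<in> d <# F" for c d u
    proof -
      obtain x y where "x \<in> F" "u = c \<otimes> x" "y \<in> F" "u = d \<otimes> y"
        using \<open>u \<in> c <# F\<close> \<open>u \<in> d <# F\<close> by (auto simp: l_coset_def)
      then show ?thesis
        using inj_onD[OF i, of "(c, x)" "(d, y)"] that(1,2) by auto
    qed
    then show "disjoint_family_on (\<lambda>c. c <# F) C"
      unfolding disjoint_family_on_def by blast
  qed
  moreover have "(\<Union>c\<in>C. c <# F) = (\<lambda>(c, x). c \<otimes> x) ` (C \<times> F)"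
    by (auto simp: l_coset_def)
  ultimately show ?thesis
    unfolding left_tiling_def bij_betw_def by auto
qed

lemma tiled_extension_iff:
  assumes "A \<subseteq> carrier G"
  shows "tiled_extension G A B \<longleftrightarrow> (\<exists>J. \<one> \<in> J \<and> J \<subseteq> carrier G \<and>
    bij_betw (\<lambda>(c, x). c \<otimes> x) (J \<times> A) B)"
  using left_tiling_iff_bij_betw[OF assms] by (auto simp: tiled_extension_def)

lemma tiled_extension_refl:
  assumes "A \<subseteq> carrier G"
  shows "tiled_extension G A A"
  unfolding tiled_extension_iff[OF assms]
proof (intro exI[of _ "{\<one>}"] conjI)
  show "bij_betw (\<lambda>(c, x). c \<otimes> x) ({\<one>} \<times> A) A"
    using assms by (auto simp: bij_betw_def inj_on_def image_iff subset_eq)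
qed auto

lemma tiled_extension_one:
  assumes "A \<subseteq> carrier G" "\<one> \<in> A"
  shows "tiled_extension G {\<one>} A"
proof -
  have "bij_betw (\<lambda>(c, x). c \<otimes> x) (A \<times> {\<one>}) A"
    using assms by (auto simp: bij_betw_def inj_on_def image_iff subset_eq)
  then show ?thesis using assms tiled_extension_iff[of "{\<one>}" A] by auto
qed

text \<open>
  Every member of a tile system is tiled by its points, so the singleton of the unit can always be
  added. Hence a group has an extendable tile at all if and only if this singleton is one.
\<close>

lemma extendable_tile_one:
  assumes "extendable_tile G A"
  shows "extendable_tile G {\<one>}"
proof -
  obtain \<F> where F: "tile_system G \<F>" "A \<in> \<F>"
    using assms by (auto simp: extendable_tile_def)
  have "tile_system G (insert {\<one>} \<F>)"
  proof (rule tile_systemI)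
    fix B assume "B \<in> insert {\<one>} \<F>"
    then show "finite B \<and> B \<subseteq> carrier G \<and> \<one> \<in> B"
      using tile_systemD[OF F(1)] by auto
  next
    fix B K and \<epsilon> :: real
    assume *: "B \<in> insert {\<one>} \<F>" "finite K" "K \<subseteq> carrier G" "\<epsilon> > 0"
    show "\<exists>C\<in>insert {\<one>} \<F>. tiled_extension G B C \<and> K \<subseteq> C \<and> almost_invariant G K \<epsilon> C"
    proof (cases "B \<in> \<F>")
      case True
      then show ?thesis using tile_system_step[OF F(1) True *(2-4)] by blast
    next
      case False
      then have "B = {\<one>}" using * by auto
      moreover obtain C where "C \<in> \<F>" "K \<subseteq> C" "almost_invariant G K \<epsilon> C"
        using tile_system_step[OF F *(2-4)] by blast
      ultimately show ?thesis
        using tiled_extension_one[of C] tile_systemD[OF F(1), of C] by auto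
    qed
  qed
  then show ?thesis by (auto simp: extendable_tile_def)
qed

lemma extendable_tile_finite_group:
  assumes "finite (carrier G)"
  shows "extendable_tile G (carrier G)"
proof -
  have e: "card {x \<in> carrier G. x \<otimes> g \<notin> carrier G} = 0" if "g \<in> carrier G" for g
  proof -
    have "{x \<in> carrier G. x \<otimes> g \<notin> carrier G} = {}" using that by auto
    then show ?thesis by (simp only: card.empty)
  qed
  have "tile_system G {carrier G}"
  proof (rule tile_systemI)
    fix A K and \<epsilon> :: real
    assume *: "A \<in> {carrier G}" "finite K" "K \<subseteq> carrier G" "\<epsilon> > 0"
    have "almost_invariant G K \<epsilon> (carrier G)"
      unfolding almost_invariant_def
    proof
      fix g assume "g \<in> K"
      then have "g \<in> carrier G" using * by blast
      then show "real (card {x \<in> carrier G. x \<otimes> g \<notin> carrier G}) \<le> \<epsilon> * real (card (carrier G))"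
        unfolding e[OF \<open>g \<in> carrier G\<close>] using * by simp
    qed
    then show "\<exists>B\<in>{carrier G}. tiled_extension G A B \<and> K \<subseteq> B \<and> almost_invariant G K \<epsilon> B"
      using * tiled_extension_refl by auto
  qed (use assms in auto)
  then show ?thesis by (auto simp: extendable_tile_def)
qed

end

section \<open>Products of tiles\<close>

context group
begin

lemma set_mult_image: "A <#> S = (\<lambda>(a, s). a \<otimes> s) ` (A \<times> S)"
  by (auto simp: set_mult_def)

text \<open>
  Moving the centres in \<open>I\<close> past \<open>A\<close> turns \<open>J I A S\<close> into \<open>J A I S\<close>, which is \<open>A' S'\<close> with unique
  factorization.
\<close>

lemma tiled_extension_set_mult:
  assumes J: "\<one> \<in> J" "J \<subseteq> carrier G" "bij_betw (\<lambda>(c, x). c \<otimes> x) (J \<times> A) A'"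
    and I: "\<one> \<in> I" "I \<subseteq> carrier G" "bij_betw (\<lambda>(c, x). c \<otimes> x) (I \<times> S) S'"
    and sub: "A \<subseteq> carrier G" "S \<subseteq> carrier G"
    and comm: "\<And>i a. i \<in> I \<Longrightarrow> a \<in> A \<Longrightarrow> i \<otimes> a = a \<otimes> i"
    and inj: "inj_on (\<lambda>(a, s). a \<otimes> s) (A' \<times> S')"
  shows "tiled_extension G (A <#> S) (A' <#> S')"
proof -
  have A': "A' = (\<lambda>(c, x). c \<otimes> x) ` (J \<times> A)" and S': "S' = (\<lambda>(c, x). c \<otimes> x) ` (I \<times> S)"
    using J(3) I(3) by (auto simp: bij_betw_def)
  have swap: "(j \<otimes> i) \<otimes> (a \<otimes> s) = (j \<otimes> a) \<otimes> (i \<otimes> s)"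
    if "j \<in> J" "i \<in> I" "a \<in> A" "s \<in> S" for j i a s
  proof -
    have c: "j \<in> carrier G" "i \<in> carrier G" "a \<in> carrier G" "s \<in> carrier G"
      using that J(2) I(2) sub by auto
    have "(j \<otimes> i) \<otimes> (a \<otimes> s) = j \<otimes> (i \<otimes> a) \<otimes> s" using c by (simp add: m_assoc)
    also have "\<dots> = (j \<otimes> a) \<otimes> (i \<otimes> s)" using c comm[OF that(2,3)] by (simp add: m_assoc)
    finally show ?thesis .
  qed
  have "inj_on (\<lambda>(c, x). c \<otimes> x) ((J <#> I) \<times> (A <#> S))"
  proof (rule inj_onI)
    fix u v assume u: "u \<in> (J <#> I) \<times> (A <#> S)" and v: "v \<in> (J <#> I) \<times> (A <#> S)"
      and eq: "(\<lambda>(c, x). c \<otimes> x) u = (\<lambda>(c, x). c \<otimes> x) v"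
    from u obtain j i a s where 1: "u = (j \<otimes> i, a \<otimes> s)" "j \<in> J" "i \<in> I" "a \<in> A" "s \<in> S"
      by (auto simp: set_mult_def)
    from v obtain j' i' a' s' where 2: "v = (j' \<otimes> i', a' \<otimes> s')" "j' \<in> J" "i' \<in> I" "a' \<in> A" "s' \<in> S"
      by (auto simp: set_mult_def)
    have "(j \<otimes> a) \<otimes> (i \<otimes> s) = (j' \<otimes> a') \<otimes> (i' \<otimes> s')"
      using eq 1 2 swap by auto
    moreover have "(j \<otimes> a, i \<otimes> s) \<in> A' \<times> S'" "(j' \<otimes> a', i' \<otimes> s') \<in> A' \<times> S'"
      using 1 2 by (auto simp: A' S')
    ultimately have "j \<otimes> a = j' \<otimes> a'" "i \<otimes> s = i' \<otimes> s'"
      using inj_onD[OF inj, of "(j \<otimes> a, i \<otimes> s)" "(j' \<otimes> a', i' \<otimes> s')"] by auto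
    then have "(j, a) = (j', a')" "(i, s) = (i', s')"
      using bij_betw_imp_inj_on[OF J(3)] bij_betw_imp_inj_on[OF I(3)] 1 2
      by (auto simp: inj_on_def)
    then show "u = v" using 1 2 by auto
  qed
  moreover have "(\<lambda>(c, x). c \<otimes> x) ` ((J <#> I) \<times> (A <#> S)) = A' <#> S'"
  proof
    show "(\<lambda>(c, x). c \<otimes> x) ` ((J <#> I) \<times> (A <#> S)) \<subseteq> A' <#> S'"
    proof
      fix x assume "x \<in> (\<lambda>(c, x). c \<otimes> x) ` ((J <#> I) \<times> (A <#> S))"
      then obtain j a i s where *: "j \<in> J" "i \<in> I" "a \<in> A" "s \<in> S" "x = (j \<otimes> i) \<otimes> (a \<otimes> s)"
        by (auto simp: set_mult_def)
      then have "x = (j \<otimes> a) \<otimes> (i \<otimes> s)" by (simp add: swap)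
      moreover have "j \<otimes> a \<in> A'" "i \<otimes> s \<in> S'" using * by (auto simp: A' S')
      ultimately show "x \<in> A' <#> S'" unfolding set_mult_def by blast
    qed
    show "A' <#> S' \<subseteq> (\<lambda>(c, x). c \<otimes> x) ` ((J <#> I) \<times> (A <#> S))"
    proof
      fix x assume "x \<in> A' <#> S'"
      then obtain j a i s where *: "j \<in> J" "i \<in> I" "a \<in> A" "s \<in> S" "x = (j \<otimes> a) \<otimes> (i \<otimes> s)"
        by (auto simp: set_mult_def A' S')
      then have "x = (\<lambda>(c, x). c \<otimes> x) (j \<otimes> i, a \<otimes> s)" by (simp add: swap)
      moreover have "(j \<otimes> i, a \<otimes> s) \<in> (J <#> I) \<times> (A <#> S)"
        using * by (auto simp: set_mult_def)
      ultimately show "x \<in> (\<lambda>(c, x). c \<otimes> x) ` ((J <#> I) \<times> (A <#> S))" by blast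
    qed
  qed
  moreover have "\<one> \<in> J <#> I" using J(1) I(1) by (force simp: set_mult_def)
  moreover have "J <#> I \<subseteq> carrier G" using J(2) I(2) by (rule set_mult_closed)
  moreover have "A <#> S \<subseteq> carrier G" using sub by (rule set_mult_closed)
  ultimately show ?thesis using tiled_extension_iff[of "A <#> S"] by (auto simp: bij_betw_def)
qed

text \<open>
  A product \<open>a s\<close> with \<open>s g = b s'\<close> is moved by \<open>g\<close> to \<open>(a b) s'\<close> and so stays in \<open>A S\<close> as long as
  \<open>a b\<close> stays in \<open>A\<close>. What escapes comes from the exceptional set \<open>E\<close>, where the \<open>S\<close>-part escapes, or
  from a small part of \<open>A\<close> for each remaining \<open>s\<close>.
\<close>

lemma card_escape_set_mult:
  assumes fin: "finite A" "finite S" and sub: "A \<subseteq> carrier G" "S \<subseteq> carrier G"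
    and inj: "inj_on (\<lambda>(a, s). a \<otimes> s) (A \<times> S)"
    and g: "g \<in> carrier G"
    and E: "E \<subseteq> S" "real (card E) \<le> \<delta> * real (card S)"
    and good: "\<And>s. s \<in> S - E \<Longrightarrow> \<exists>b\<in>carrier G. \<exists>s'\<in>S. s \<otimes> g = b \<otimes> s' \<and>
      real (card {a \<in> A. a \<otimes> b \<notin> A}) \<le> \<epsilon> * real (card A)"
    and "\<epsilon> \<ge> 0"
  shows "real (card {x \<in> A <#> S. x \<otimes> g \<notin> A <#> S}) \<le> (\<delta> + \<epsilon>) * real (card (A <#> S))"
proof -
  let ?X = "{x \<in> A <#> S. x \<otimes> g \<notin> A <#> S}"
  have cAS: "card (A <#> S) = card A * card S"
    unfolding set_mult_image using inj by (simp add: card_image card_cartesian_product)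
  have "\<forall>s\<in>S - E. \<exists>b. b \<in> carrier G \<and> (\<exists>s'\<in>S. s \<otimes> g = b \<otimes> s') \<and>
      real (card {a \<in> A. a \<otimes> b \<notin> A}) \<le> \<epsilon> * real (card A)"
    using good by blast
  from bchoice[OF this] obtain b where
    b: "\<And>s. s \<in> S - E \<Longrightarrow> b s \<in> carrier G \<and> (\<exists>s'\<in>S. s \<otimes> g = b s \<otimes> s') \<and>
      real (card {a \<in> A. a \<otimes> b s \<notin> A}) \<le> \<epsilon> * real (card A)"
    by blast
  let ?Y = "\<lambda>s. (\<lambda>a. a \<otimes> s) ` {a \<in> A. a \<otimes> b s \<notin> A}"
  have "?X \<subseteq> (A <#> E) \<union> (\<Union>s\<in>S - E. ?Y s)"
  proof
    fix x assume x: "x \<in> ?X"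
    then obtain a s where as: "a \<in> A" "s \<in> S" "x = a \<otimes> s" by (auto simp: set_mult_def)
    show "x \<in> (A <#> E) \<union> (\<Union>s\<in>S - E. ?Y s)"
    proof (cases "s \<in> E")
      case True
      then show ?thesis using as by (auto simp: set_mult_def)
    next
      case False
      then obtain s' where bs: "b s \<in> carrier G" "s' \<in> S" "s \<otimes> g = b s \<otimes> s'"
        using b[of s] as by blast
      have c: "a \<in> carrier G" "s \<in> carrier G" "s' \<in> carrier G" using as bs sub by auto
      have "x \<otimes> g = a \<otimes> (s \<otimes> g)" using as c g by (simp add: m_assoc)
      also have "\<dots> = (a \<otimes> b s) \<otimes> s'" using bs c by (simp add: m_assoc)
      finally have "x \<otimes> g = (a \<otimes> b s) \<otimes> s'" .
      then have "a \<otimes> b s \<notin> A" using x bs(2) by (auto simp: set_mult_def)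
      then show ?thesis using as False by auto
    qed
  qed
  then have "card ?X \<le> card ((A <#> E) \<union> (\<Union>s\<in>S - E. ?Y s))"
    using fin E(1) finite_subset[OF E(1)] by (intro card_mono) (auto simp: set_mult_image)
  also have "\<dots> \<le> card (A <#> E) + card (\<Union>s\<in>S - E. ?Y s)" by (rule card_Un_le)
  also have "\<dots> \<le> card A * card E + (\<Sum>s\<in>S - E. card {a \<in> A. a \<otimes> b s \<notin> A})"
  proof (rule add_mono)
    show "card (A <#> E) \<le> card A * card E"
      unfolding set_mult_image using card_image_le[of "A \<times> E"] fin finite_subset[OF E(1)]
      by (simp add: card_cartesian_product)
    have "card (\<Union>s\<in>S - E. ?Y s) \<le> (\<Sum>s\<in>S - E. card (?Y s))"
      using fin by (intro card_UN_le) auto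
    also have "\<dots> \<le> (\<Sum>s\<in>S - E. card {a \<in> A. a \<otimes> b s \<notin> A})"
      using fin by (intro sum_mono card_image_le) auto
    finally show "card (\<Union>s\<in>S - E. ?Y s) \<le> (\<Sum>s\<in>S - E. card {a \<in> A. a \<otimes> b s \<notin> A})" .
  qed
  finally have "real (card ?X) \<le> real (card A * card E + (\<Sum>s\<in>S - E. card {a \<in> A. a \<otimes> b s \<notin> A}))"
    by (rule of_nat_mono)
  also have "\<dots> = real (card A) * real (card E) + (\<Sum>s\<in>S - E. real (card {a \<in> A. a \<otimes> b s \<notin> A}))"
    by simp
  also have "\<dots> \<le> real (card A) * (\<delta> * real (card S)) + (\<Sum>s\<in>S - E. \<epsilon> * real (card A))"
    using E(2) b by (intro add_mono mult_left_mono sum_mono) auto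
  also have "(\<Sum>s\<in>S - E. \<epsilon> * real (card A)) \<le> (\<Sum>s\<in>S. \<epsilon> * real (card A))"
    using fin \<open>\<epsilon> \<ge> 0\<close> by (intro sum_mono2) auto
  finally show ?thesis by (simp add: cAS algebra_simps)
qed

end

section \<open>Subgroups of finite index\<close>

lemma almost_invariant_update_carrier [simp]:
  "almost_invariant (G\<lparr>carrier := H\<rparr>) = almost_invariant G"
  by (simp add: almost_invariant_def fun_eq_iff)

context group
begin

lemma tiled_extension_subgroup:
  assumes "subgroup H G" "A \<subseteq> H" "tiled_extension (G\<lparr>carrier := H\<rparr>) A B"
  obtains J where "\<one> \<in> J" "J \<subseteq> H" "bij_betw (\<lambda>(c, x). c \<otimes> x) (J \<times> A) B"
proof -
  interpret H: group "G\<lparr>carrier := H\<rparr>" using assms(1) by (rule subgroup_imp_group)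
  show thesis using that H.tiled_extension_iff[of A B] assms(2,3) by auto
qed

lemma right_transversal:
  assumes H: "subgroup H G" and fin: "finite (rcosets H)"
  obtains S where "finite S" "S \<subseteq> carrier G" "\<one> \<in> S"
    "inj_on (\<lambda>(h, s). h \<otimes> s) (H \<times> S)" "H <#> S = carrier G"
proof -
  define r where "r R = (if R = H then \<one> else SOME x. x \<in> R)" for R
  have r: "r R \<in> carrier G \<and> r R \<in> R \<and> R = H #> r R" if R: "R \<in> rcosets H" for R
  proof -
    obtain a where a: "a \<in> carrier G" "R = H #> a" using R by (auto simp: RCOSETS_def)
    then have "a \<in> R" using rcos_self[OF _ H] by auto
    then have rR: "r R \<in> R"
      using subgroup.one_closed[OF H] by (auto simp: r_def intro: someI)
    have "R \<subseteq> carrier G" using a r_coset_subset_G[OF subgroup.subset[OF H]] by auto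
    then show ?thesis using rR repr_independence[of "r R" H a] a H by auto
  qed
  define S where "S = r ` (rcosets H)"
  have "H \<in> rcosets H" using subgroup.subgroup_in_rcosets[OF H group_axioms] .
  then have one: "\<one> \<in> S" by (force simp: S_def r_def)
  have S: "S \<subseteq> carrier G" using r by (auto simp: S_def)
  have rS: "r (H #> s) = s" if "s \<in> S" for s using that r by (auto simp: S_def)
  have "inj_on (\<lambda>(h, s). h \<otimes> s) (H \<times> S)"
  proof (rule inj_onI, clarsimp)
    fix h s h' s' assume *: "h \<in> H" "s \<in> S" "h' \<in> H" "s' \<in> S" "h \<otimes> s = h' \<otimes> s'"
    have c: "h \<in> carrier G" "h' \<in> carrier G" "s \<in> carrier G" "s' \<in> carrier G"
      using * S subgroup.subset[OF H] by auto
    have "h \<otimes> s \<in> H #> s" "h' \<otimes> s' \<in> H #> s'"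
      unfolding r_coset_def using *(1,3) by blast+
    then have "H #> s = H #> s'" using repr_independence[OF _ c(3) H] repr_independence[OF _ c(4) H] *(5)
      by metis
    then have "s = s'" using rS *(2,4) by metis
    then show "h = h' \<and> s = s'" using * c by (metis r_cancel)
  qed
  moreover have "H <#> S = carrier G"
  proof
    show "H <#> S \<subseteq> carrier G" using set_mult_closed[OF subgroup.subset[OF H] S] .
    show "carrier G \<subseteq> H <#> S"
    proof
      fix x assume x: "x \<in> carrier G"
      have R: "H #> x \<in> rcosets H" using x subgroup.subset[OF H] by (rule rcosetsI[rotated])
      have "x \<in> H #> r (H #> x)" using r[OF R] rcos_self[OF x H] by auto
      then show "x \<in> H <#> S" using R by (auto simp: r_coset_def set_mult_def S_def)
    qed
  qed
  moreover have "finite S" using fin by (simp add: S_def)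
  ultimately show thesis using that[of S] one S by blast
qed

text \<open>
  The products \<open>A S\<close> with a fixed right transversal \<open>S\<close> form a tile system. As \<open>S\<close> never grows, the
  centres that tile \<open>B\<close> by \<open>A\<close> also tile \<open>B S\<close> by \<open>A S\<close>.
\<close>

lemma extendable_tile_finite_index:
  assumes H: "subgroup H G" and fin: "finite (rcosets H)"
    and ext: "extendable_tile (G\<lparr>carrier := H\<rparr>) A"
  shows "extendable_tile G {\<one>}"
proof -
  obtain S where S: "finite S" "S \<subseteq> carrier G" "\<one> \<in> S"
    and inj: "inj_on (\<lambda>(h, s). h \<otimes> s) (H \<times> S)" and HS: "H <#> S = carrier G"
    using right_transversal[OF H fin] by blast
  have Hc: "H \<subseteq> carrier G" using subgroup.subset[OF H] .
  obtain \<F> where F: "tile_system (G\<lparr>carrier := H\<rparr>) \<F>" "A \<in> \<F>"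
    using ext by (auto simp: extendable_tile_def)
  have FA: "finite B" "B \<subseteq> H" "\<one> \<in> B" if "B \<in> \<F>" for B
    using tile_systemD[OF F(1) that] by auto
  have "\<exists>h\<in>H. \<exists>s\<in>S. x = h \<otimes> s" if "x \<in> carrier G" for x
  proof -
    have "x \<in> H <#> S" using that HS by simp
    then show ?thesis unfolding set_mult_def by blast
  qed
  then obtain h s where hs: "\<And>x. x \<in> carrier G \<Longrightarrow> h x \<in> H \<and> s x \<in> S \<and> x = h x \<otimes> s x"
    by metis
  have "tile_system G ((\<lambda>A. A <#> S) ` \<F>)"
  proof (rule tile_systemI)
    fix C assume "C \<in> (\<lambda>A. A <#> S) ` \<F>"
    then obtain B where B: "B \<in> \<F>" "C = B <#> S" by auto
    have "\<one> \<otimes> \<one> \<in> C" unfolding B set_mult_def using FA(3)[OF B(1)] S(3) by blast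
    moreover have "finite C" unfolding B set_mult_image using FA(1)[OF B(1)] S(1) by simp
    moreover have "C \<subseteq> carrier G"
      unfolding B using set_mult_closed[of B S] FA(2)[OF B(1)] Hc S(2) by auto
    ultimately show "finite C \<and> C \<subseteq> carrier G \<and> \<one> \<in> C" by simp
  next
    fix C K and \<epsilon> :: real
    assume "C \<in> (\<lambda>A. A <#> S) ` \<F>" and K: "finite K" "K \<subseteq> carrier G" and e: "\<epsilon> > 0"
    then obtain A where A: "A \<in> \<F>" "C = A <#> S" by auto
    \<comment> \<open>The carries that arise when the transversal is multiplied by \<open>K\<close>; for \<open>s = \<one>\<close> they are
      the \<open>H\<close>-parts of the elements of \<open>K\<close>, which gives \<open>K \<subseteq> B S\<close> below.\<close>
    define L where "L = (\<lambda>(s, g). h (s \<otimes> g)) ` (S \<times> K)"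
    have L: "finite L" "L \<subseteq> H"
      using S K hs by (auto simp: L_def subset_eq)
    obtain B where B: "B \<in> \<F>" "tiled_extension (G\<lparr>carrier := H\<rparr>) A B" "L \<subseteq> B"
        "almost_invariant G L \<epsilon> B"
      using tile_system_step[OF F(1) A(1), of L \<epsilon>] L e by auto
    obtain J where J: "\<one> \<in> J" "J \<subseteq> H" "bij_betw (\<lambda>(c, x). c \<otimes> x) (J \<times> A) B"
      using tiled_extension_subgroup[OF H FA(2)[OF A(1)] B(2)] .
    have inj': "inj_on (\<lambda>(a, s). a \<otimes> s) (B \<times> S)"
      using inj FA(2)[OF B(1)] by (auto elim!: inj_on_subset)
    have "tiled_extension G C (B <#> S)"
      unfolding A(2)
    proof (rule tiled_extension_set_mult[where I = "{\<one>}", OF J(1) _ J(3)])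
      show "bij_betw (\<lambda>(c, x). c \<otimes> x) ({\<one>} \<times> S) S"
        using S(2) by (auto simp: bij_betw_def inj_on_def image_iff subset_eq)
      show "i \<otimes> a = a \<otimes> i" if "i \<in> {\<one>}" "a \<in> A" for i a
        using that FA(2)[OF A(1)] Hc by auto
    qed (use J Hc FA(2)[OF A(1)] S inj' in auto)
    moreover have "K \<subseteq> B <#> S"
    proof
      fix g assume g: "g \<in> K"
      then have "g \<in> carrier G" using K by auto
      then have "h g = (\<lambda>(s, g). h (s \<otimes> g)) (\<one>, g)" by simp
      then have "h g \<in> B" using S(3) g B(3) unfolding L_def by blast
      then show "g \<in> B <#> S"
        using hs[OF \<open>g \<in> carrier G\<close>] unfolding set_mult_def by blast
    qed
    moreover have "almost_invariant G K \<epsilon> (B <#> S)"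
      unfolding almost_invariant_def
    proof
      fix g assume g: "g \<in> K"
      have "real (card {x \<in> B <#> S. x \<otimes> g \<notin> B <#> S}) \<le> (0 + \<epsilon>) * real (card (B <#> S))"
      proof (rule card_escape_set_mult[where E = "{}"])
        fix t assume t: "t \<in> S - {}"
        then have tg: "t \<otimes> g \<in> carrier G" using S K g by auto
        have "h (t \<otimes> g) \<in> L" using t g by (auto simp: L_def)
        then have "real (card {a \<in> B. a \<otimes> h (t \<otimes> g) \<notin> B}) \<le> \<epsilon> * real (card B)"
          using B(4) by (auto simp: almost_invariant_def)
        then show "\<exists>b\<in>carrier G. \<exists>s'\<in>S. t \<otimes> g = b \<otimes> s' \<and>
            real (card {a \<in> B. a \<otimes> b \<notin> B}) \<le> \<epsilon> * real (card B)"
          using hs[OF tg] Hc by blast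
      qed (use FA[OF B(1)] Hc S inj' g K e in auto)
      then show "real (card {x \<in> B <#> S. x \<otimes> g \<notin> B <#> S}) \<le> \<epsilon> * real (card (B <#> S))"
        by simp
    qed
    ultimately show "\<exists>B\<in>(\<lambda>A. A <#> S) ` \<F>. tiled_extension G C B \<and> K \<subseteq> B \<and>
        almost_invariant G K \<epsilon> B"
      using B(1) by blast
  qed
  then show ?thesis
    using F(2) extendable_tile_one by (auto simp: extendable_tile_def)
qed

end

section \<open>Central extensions\<close>

text \<open>
  The tile system consists of the products \<open>A S\<close> with \<open>A\<close> a tile of the kernel and \<open>S\<close> an injective
  lift of a tile of the quotient. The lift is enlarged by lifting the centres of the tiling
  in the quotient, so that \<open>S\<close> itself, and not just its image, is tiled. Taking
  \<open>S = {\<one>}\<close> shows that a tile of the kernel is an extendable tile of the whole group, which is what makes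
  it possible to pass to unions of subgroups.
\<close>

lemma (in group_hom) extendable_tile_central_extension:
  assumes surj: "h ` carrier G = carrier H"
    and central: "\<And>z g. z \<in> kernel G H h \<Longrightarrow> g \<in> carrier G \<Longrightarrow> z \<otimes> g = g \<otimes> z"
    and Z: "extendable_tile (G\<lparr>carrier := kernel G H h\<rparr>) A0"
    and Q: "extendable_tile H {\<one>\<^bsub>H\<^esub>}"
  shows "extendable_tile G A0"
proof -
  let ?Z = "kernel G H h"
  have subZ: "subgroup ?Z G" by (rule subgroup_kernel)
  have Zc: "?Z \<subseteq> carrier G" using subgroup.subset[OF subZ] .
  obtain \<A> where ZZ: "tile_system (G\<lparr>carrier := ?Z\<rparr>) \<A>" "A0 \<in> \<A>"
    using Z by (auto simp: extendable_tile_def)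
  obtain \<Q> where QQ: "tile_system H \<Q>" "{\<one>\<^bsub>H\<^esub>} \<in> \<Q>"
    using Q by (auto simp: extendable_tile_def)
  have ZA: "finite B" "B \<subseteq> ?Z" "\<one> \<in> B" if "B \<in> \<A>" for B
    using tile_systemD[OF ZZ(1) that] by auto
  define lift where "lift S \<longleftrightarrow> S \<subseteq> carrier G \<and> \<one> \<in> S \<and> inj_on h S \<and> h ` S \<in> \<Q>" for S
  have lift_fin: "finite S" if "lift S" for S
    using that tile_systemD(1)[OF QQ(1), of "h ` S"] finite_imageD by (auto simp: lift_def)
  define \<F> where "\<F> = {A <#> S | A S. A \<in> \<A> \<and> lift S}"
  have "tile_system G \<F>"
  proof (rule tile_systemI)
    fix C assume "C \<in> \<F>"
    then obtain A S where C: "A \<in> \<A>" "lift S" "C = A <#> S" by (auto simp: \<F>_def)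
    have "\<one> \<in> S" using C(2) by (simp add: lift_def)
    then have "\<one> \<otimes> \<one> \<in> C" unfolding C set_mult_def using ZA(3)[OF C(1)] by blast
    moreover have "finite C"
      unfolding C G.set_mult_image using ZA(1)[OF C(1)] lift_fin[OF C(2)] by simp
    moreover have "C \<subseteq> carrier G"
      unfolding C using G.set_mult_closed[of A S] ZA(2)[OF C(1)] Zc C(2) by (auto simp: lift_def)
    ultimately show "finite C \<and> C \<subseteq> carrier G \<and> \<one> \<in> C" by simp
  next
    fix C K and \<epsilon> :: real
    assume "C \<in> \<F>" and K: "finite K" "K \<subseteq> carrier G" and e: "\<epsilon> > 0"
    then obtain A S where C: "A \<in> \<A>" "lift S" "C = A <#> S" by (auto simp: \<F>_def)
    have S: "S \<subseteq> carrier G" "\<one> \<in> S" "inj_on h S" "h ` S \<in> \<Q>" using C(2) by (auto simp: lift_def)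
    have Kh: "h ` K \<subseteq> carrier H" using K by auto
    obtain B where B: "B \<in> \<Q>" "tiled_extension H (h ` S) B" "h ` K \<subseteq> B"
        "almost_invariant H (h ` K) (\<epsilon>/2) B"
      using tile_system_step[OF QQ(1) S(4), of "h ` K" "\<epsilon>/2"] Kh K e by auto
    have hS: "h ` S \<subseteq> carrier H" using S by auto
    obtain J where J: "\<one>\<^bsub>H\<^esub> \<in> J" "J \<subseteq> carrier H"
        "bij_betw (\<lambda>(c, x). c \<otimes>\<^bsub>H\<^esub> x) (J \<times> h ` S) B"
      using B(2) H.tiled_extension_iff[OF hS] by auto
    \<comment> \<open>The unit has to be lifted to the unit, as it must be among the new centres.\<close>
    define l where "l j = (if j = \<one>\<^bsub>H\<^esub> then \<one> else SOME x. x \<in> carrier G \<and> h x = j)" for j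
    have l: "l j \<in> carrier G \<and> h (l j) = j" if "j \<in> J" for j
    proof (cases "j = \<one>\<^bsub>H\<^esub>")
      case False
      have "\<exists>x. x \<in> carrier G \<and> h x = j" using that J(2) surj by (metis imageE subsetD)
      from someI_ex[OF this] show ?thesis using False by (simp add: l_def)
    qed (simp add: l_def)
    define I where "I = l ` J"
    have I: "\<one> \<in> I" "I \<subseteq> carrier G" using l J(1) by (force simp: I_def l_def)+
    define S' where "S' = (\<lambda>(c, x). c \<otimes> x) ` (I \<times> S)"
    have hm: "h (c \<otimes> x) = h c \<otimes>\<^bsub>H\<^esub> h x" if "c \<in> I" "x \<in> S" for c x
      using that I(2) S(1) by (intro hom_mult) auto
    have hI: "h c \<in> J \<and> c = l (h c)" if "c \<in> I" for c using that l by (auto simp: I_def)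
    have key: "c = d \<and> x = y" if "c \<in> I" "d \<in> I" "x \<in> S" "y \<in> S" "h (c \<otimes> x) = h (d \<otimes> y)" for c d x y
    proof -
      have "(h c, h x) = (h d, h y)"
        using inj_onD[OF bij_betw_imp_inj_on[OF J(3)], of "(h c, h x)" "(h d, h y)"] that hm hI
        by auto
      then show ?thesis using that hI inj_onD[OF S(3)] by (metis prod.inject)
    qed
    have bijS': "bij_betw (\<lambda>(c, x). c \<otimes> x) (I \<times> S) S'"
      unfolding bij_betw_def S'_def by (rule conjI, rule inj_onI) (use key in auto)
    have injS': "inj_on h S'"
      by (rule inj_onI) (use key in \<open>auto simp: S'_def\<close>)
    have "h ` S' = (\<lambda>(c, x). c \<otimes>\<^bsub>H\<^esub> x) ` (J \<times> h ` S)"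
    proof -
      have "h ` S' = (\<lambda>(c, x). h c \<otimes>\<^bsub>H\<^esub> h x) ` (I \<times> S)"
        unfolding S'_def image_image by (rule image_cong) (use hm in auto)
      also have "\<dots> = (\<lambda>(c, x). c \<otimes>\<^bsub>H\<^esub> x) ` (h ` I \<times> h ` S)" by force
      also have "h ` I = J" using l by (force simp: I_def)
      finally show ?thesis .
    qed
    then have hS': "h ` S' = B" using bij_betw_imp_surj_on[OF J(3)] by simp
    have S'c: "S' \<subseteq> carrier G" using I(2) S(1) by (auto simp: S'_def)
    have "\<one> \<otimes> \<one> \<in> S'" unfolding S'_def using I(1) S(2) by blast
    then have one: "\<one> \<in> S'" by simp
    have liftS': "lift S'" using S'c one injS' hS' B(1) by (simp add: lift_def)
    have finS': "finite S'" using lift_fin[OF liftS'] .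
    \<comment> \<open>The carries into the kernel. They depend on \<open>S'\<close>, so the kernel tile is enlarged last.\<close>
    define L where "L = {(s \<otimes> g) \<otimes> inv t | s g t. s \<in> S' \<and> g \<in> K \<and> t \<in> S' \<and> h (s \<otimes> g) = h t}"
    have "L \<subseteq> (\<lambda>(s, g, t). (s \<otimes> g) \<otimes> inv t) ` (S' \<times> K \<times> S')" by (force simp: L_def)
    then have finL: "finite L" using finS' K by (auto elim!: finite_subset)
    have LZ: "L \<subseteq> ?Z"
    proof
      fix b assume "b \<in> L"
      then obtain s g t where *: "b = (s \<otimes> g) \<otimes> inv t" "s \<in> S'" "g \<in> K" "t \<in> S'" "h (s \<otimes> g) = h t"
        by (auto simp: L_def)
      then have c: "s \<in> carrier G" "g \<in> carrier G" "t \<in> carrier G" using S'c K by auto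
      have "h b = h (s \<otimes> g) \<otimes>\<^bsub>H\<^esub> inv\<^bsub>H\<^esub> h t" using * c by simp
      then have "h b = \<one>\<^bsub>H\<^esub>" using c by (simp only: *(5)) simp
      then show "b \<in> ?Z" using * c by (simp add: kernel_def)
    qed
    have split: "\<exists>b\<in>L. s \<otimes> g = b \<otimes> t"
      if "s \<in> S'" "g \<in> K" "t \<in> S'" "h (s \<otimes> g) = h t" for s g t
    proof
      show "(s \<otimes> g) \<otimes> inv t \<in> L" using that by (auto simp: L_def)
      have "s \<in> carrier G" "g \<in> carrier G" "t \<in> carrier G" using that S'c K by auto
      then show "s \<otimes> g = (s \<otimes> g) \<otimes> inv t \<otimes> t" by (simp add: G.m_assoc)
    qed
    obtain A' where A': "A' \<in> \<A>" "tiled_extension (G\<lparr>carrier := ?Z\<rparr>) A A'" "L \<subseteq> A'"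
        "almost_invariant G L (\<epsilon>/2) A'"
      using tile_system_step[OF ZZ(1) C(1), of L "\<epsilon>/2"] finL LZ e by auto
    obtain D where D: "\<one> \<in> D" "D \<subseteq> ?Z" "bij_betw (\<lambda>(c, x). c \<otimes> x) (D \<times> A) A'"
      using G.tiled_extension_subgroup[OF subZ ZA(2)[OF C(1)] A'(2)] .
    have A'c: "A' \<subseteq> carrier G" using ZA(2)[OF A'(1)] Zc by auto
    have inj': "inj_on (\<lambda>(a, s). a \<otimes> s) (A' \<times> S')"
    proof (rule inj_onI, clarsimp)
      fix a s b t assume *: "a \<in> A'" "s \<in> S'" "b \<in> A'" "t \<in> S'" "a \<otimes> s = b \<otimes> t"
      then have c: "a \<in> carrier G" "s \<in> carrier G" "b \<in> carrier G" "t \<in> carrier G"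
        using A'c S'c by auto
      have k: "h a = \<one>\<^bsub>H\<^esub>" "h b = \<one>\<^bsub>H\<^esub>" using * ZA(2)[OF A'(1)] by (auto simp: kernel_def)
      have "h (a \<otimes> s) = h (b \<otimes> t)" using * by simp
      then have "h s = h t" using c k by simp
      then have "s = t" using * injS' by (auto dest: inj_onD)
      then show "a = b \<and> s = t" using * c by simp
    qed
    have "tiled_extension G C (A' <#> S')"
      unfolding C(3)
    proof (rule G.tiled_extension_set_mult[OF D(1) _ D(3) I bijS' _ S(1) _ inj'])
      show "i \<otimes> a = a \<otimes> i" if "i \<in> I" "a \<in> A" for i a
      proof -
        have "a \<in> ?Z" "i \<in> carrier G" using that ZA(2)[OF C(1)] I(2) by auto
        then show ?thesis by (rule central[symmetric])
      qed
    qed (use D Zc ZA(2)[OF C(1)] in auto)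
    moreover have "K \<subseteq> A' <#> S'"
    proof
      fix g assume g: "g \<in> K"
      then have gc: "g \<in> carrier G" using K by auto
      have "h g \<in> h ` S'" using g B(3) hS' by auto
      then obtain t where t: "t \<in> S'" "h g = h t" by auto
      then obtain b where "b \<in> L" "\<one> \<otimes> g = b \<otimes> t" using split[OF one g t(1)] gc by auto
      then have "b \<in> A'" "g = b \<otimes> t" using A'(3) gc by auto
      then show "g \<in> A' <#> S'" using t(1) unfolding set_mult_def by blast
    qed
    moreover have "almost_invariant G K \<epsilon> (A' <#> S')"
      unfolding almost_invariant_def
    proof
      fix g assume g: "g \<in> K"
      then have gc: "g \<in> carrier G" using K by auto
      \<comment> \<open>The elements whose image leaves \<open>B\<close>, for which no carry is available.\<close>
      define E where "E = {s \<in> S'. h s \<otimes>\<^bsub>H\<^esub> h g \<notin> B}"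
      have "card E = card (h ` E)"
        using injS' by (intro card_image[symmetric]) (auto simp: E_def inj_on_def)
      also have "h ` E = {y \<in> B. y \<otimes>\<^bsub>H\<^esub> h g \<notin> B}" by (auto simp: E_def hS'[symmetric])
      finally have "real (card E) \<le> \<epsilon>/2 * real (card B)"
        using B(4) g by (auto simp: almost_invariant_def)
      also have "card B = card S'" using card_image[OF injS'] hS' by simp
      finally have cE: "real (card E) \<le> \<epsilon>/2 * real (card S')" .
      have "real (card {x \<in> A' <#> S'. x \<otimes> g \<notin> A' <#> S'}) \<le> (\<epsilon>/2 + \<epsilon>/2) * real (card (A' <#> S'))"
      proof (rule G.card_escape_set_mult[OF _ finS' A'c S'c inj' gc _ cE])
        fix s assume s: "s \<in> S' - E"
        then have sc: "s \<in> carrier G" using S'c by auto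
        have "h (s \<otimes> g) \<in> h ` S'" using s sc gc by (auto simp: E_def hS')
        then obtain t where t: "t \<in> S'" "h (s \<otimes> g) = h t" by auto
        then obtain b where b: "b \<in> L" "s \<otimes> g = b \<otimes> t" using split[OF _ g t(1)] s by auto
        have "real (card {a \<in> A'. a \<otimes> b \<notin> A'}) \<le> \<epsilon>/2 * real (card A')"
          using A'(4) b(1) by (auto simp: almost_invariant_def)
        then show "\<exists>b\<in>carrier G. \<exists>t\<in>S'. s \<otimes> g = b \<otimes> t \<and>
            real (card {a \<in> A'. a \<otimes> b \<notin> A'}) \<le> \<epsilon>/2 * real (card A')"
          using b t LZ Zc by blast
      qed (use ZA[OF A'(1)] e in \<open>auto simp: E_def\<close>)
      then show "real (card {x \<in> A' <#> S'. x \<otimes> g \<notin> A' <#> S'}) \<le> \<epsilon> * real (card (A' <#> S'))"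
        by simp
    qed
    ultimately show "\<exists>B\<in>\<F>. tiled_extension G C B \<and> K \<subseteq> B \<and> almost_invariant G K \<epsilon> B"
      using A'(1) liftS' by (auto simp: \<F>_def)
  qed
  moreover have "A0 \<in> \<F>"
  proof -
    have "lift {\<one>}" using QQ(2) by (simp add: lift_def)
    moreover have "A0 <#> {\<one>} = A0"
      using ZA(2)[OF ZZ(2)] Zc by (force simp: set_mult_def)
    ultimately show ?thesis using ZZ(2) unfolding \<F>_def by blast
  qed
  ultimately show ?thesis by (auto simp: extendable_tile_def)
qed

section \<open>Cyclic groups\<close>

text \<open>
  This is division by \<open>2 L + 1\<close> with the remainder taken in \<open>{-L..L}\<close>. Intervals that are symmetric
  about zero exhaust the integers, and the number of copies is odd so that zero is a centre.
\<close>

lemma symmetric_interval_tiling: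
  fixes L m :: int
  assumes "L \<ge> 0" "m \<ge> 0"
  shows "bij_betw (\<lambda>(j, i). (2 * L + 1) * j + i) ({-m..m} \<times> {-L..L})
    {-(L + (2 * L + 1) * m)..L + (2 * L + 1) * m}"
proof -
  define d where "d = 2 * L + 1"
  have d: "d > 0" using assms by (simp add: d_def)
  have dv: "(d * j + i + L) div d = j" if "i \<in> {-L..L}" for i j
  proof -
    have "(d * j + i + L) div d = ((i + L) + d * j) div d" by (simp add: algebra_simps)
    also have "\<dots> = j + (i + L) div d" using d by (simp add: div_mult_self2)
    also have "(i + L) div d = 0" using that by (auto simp: d_def intro: div_pos_pos_trivial)
    finally show ?thesis by simp
  qed
  have inj: "inj_on (\<lambda>(j, i). d * j + i) ({-m..m} \<times> {-L..L})"
  proof (rule inj_onI)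
    fix u v assume u: "u \<in> {-m..m} \<times> {-L..L}" and v: "v \<in> {-m..m} \<times> {-L..L}"
      and eq: "(\<lambda>(j, i). d * j + i) u = (\<lambda>(j, i). d * j + i) v"
    have "fst u = fst v"
      using dv[of "snd u" "fst u"] dv[of "snd v" "fst v"] u v eq by (auto simp: case_prod_beta)
    then show "u = v" using eq by (auto simp: case_prod_beta prod_eq_iff)
  qed
  have "(\<lambda>(j, i). d * j + i) ` ({-m..m} \<times> {-L..L}) = {-(L + d * m)..L + d * m}"
  proof
    have "d * j + i \<in> {-(L + d * m)..L + d * m}" if "j \<in> {-m..m}" "i \<in> {-L..L}" for i j
    proof -
      have "d * j \<le> d * m" using that d by (simp add: mult_left_mono)
      moreover have "d * (-m) \<le> d * j" using that d by (intro mult_left_mono) auto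
      ultimately show ?thesis using that by auto
    qed
    then show "(\<lambda>(j, i). d * j + i) ` ({-m..m} \<times> {-L..L}) \<subseteq> {-(L + d * m)..L + d * m}" by auto
    show "{-(L + d * m)..L + d * m} \<subseteq> (\<lambda>(j, i). d * j + i) ` ({-m..m} \<times> {-L..L})"
    proof
      fix t assume t: "t \<in> {-(L + d * m)..L + d * m}"
      define j where "j = (t + L) div d"
      define i where "i = (t + L) mod d - L"
      have "t = d * j + i" using mult_div_mod_eq[of d "t + L"] unfolding i_def j_def by linarith
      moreover have i: "i \<in> {-L..L}"
        using pos_mod_bound[OF d, of "t + L"] pos_mod_sign[OF d, of "t + L"]
        d_def unfolding i_def atLeastAtMost_iff by linarith
      moreover have "j \<in> {-m..m}"
      proof -
        have "t \<le> L + d * m" "- (L + d * m) \<le> t" "- L \<le> i" "i \<le> L" using t i by auto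
        moreover have "d * j = t - i" "2 * L < d" using \<open>t = d * j + i\<close> d_def by linarith+
        ultimately have "d * j < d * m + d" "- (d * m) - d < d * j" by linarith+
        then have "d * j < d * (m + 1)" "d * (- m - 1) < d * j"
          by (simp_all add: distrib_left right_diff_distrib)
        then have "j < m + 1" "- m - 1 < j" by (simp_all only: mult_less_cancel_left_pos[OF d])
        then show ?thesis by simp
      qed
      ultimately show "t \<in> (\<lambda>(j, i). d * j + i) ` ({-m..m} \<times> {-L..L})"
        by (intro image_eqI[of _ _ "(j, i)"]) simp_all
    qed
  qed
  then show ?thesis using bij_betw_imageI[OF inj] unfolding d_def by blast
qed

context group
begin

lemma extendable_tile_infinite_cyclic:
  assumes x: "x \<in> carrier G" and gen: "carrier G = range (\<lambda>i::int. x [^] i)"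
    and inj: "inj (\<lambda>i::int. x [^] i)"
  shows "extendable_tile G {\<one>}"
proof -
  define P where "P L = (\<lambda>i::int. x [^] i) ` {-L..L}" for L :: int
  have Pc: "P L \<subseteq> carrier G" for L using x by (auto simp: P_def)
  have mem: "x [^] i \<in> P L \<longleftrightarrow> i \<in> {-L..L}" for i L
    unfolding P_def using inj_image_mem_iff[OF inj] .
  have cardP: "card (P L) = nat (2 * L + 1)" for L
  proof -
    have "card (P L) = card {-L..L}" unfolding P_def
      by (rule card_image) (rule inj_on_subset[OF inj], simp)
    then show ?thesis by simp
  qed
  have ext: "tiled_extension G (P L) (P (L + (2 * L + 1) * m))" if "L \<ge> 0" "m \<ge> 0" for L m
  proof -
    let ?J = "(\<lambda>j::int. x [^] ((2 * L + 1) * j)) ` {-m..m}"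
    let ?f = "\<lambda>(j, i). (2 * L + 1) * j + i"
    let ?p = "\<lambda>i::int. x [^] i"
    have f: "bij_betw ?f ({-m..m} \<times> {-L..L}) {-(L + (2 * L + 1) * m)..L + (2 * L + 1) * m}"
      using symmetric_interval_tiling[OF that] .
    have eq: "?J \<times> P L = (\<lambda>(j, i). (?p ((2 * L + 1) * j), ?p i)) ` ({-m..m} \<times> {-L..L})"
      by (auto simp: P_def)
    have mul: "(\<lambda>(c, y). c \<otimes> y) (?p ((2 * L + 1) * j), ?p i) = ?p (?f (j, i))" for j i
      using x by (simp add: int_pow_mult)
    have "(\<lambda>(c, y). c \<otimes> y) ` (?J \<times> P L) = ?p ` (?f ` ({-m..m} \<times> {-L..L}))"
      unfolding eq image_image by (rule image_cong) (use mul in auto)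
    also have "\<dots> = P (L + (2 * L + 1) * m)"
      using bij_betw_imp_surj_on[OF f] by (simp add: P_def)
    finally have surj: "(\<lambda>(c, y). c \<otimes> y) ` (?J \<times> P L) = P (L + (2 * L + 1) * m)" .
    have "inj_on (\<lambda>(c, y). c \<otimes> y) (?J \<times> P L)"
    proof (rule inj_onI)
      fix u v assume "u \<in> ?J \<times> P L" "v \<in> ?J \<times> P L" and e: "(\<lambda>(c, y). c \<otimes> y) u = (\<lambda>(c, y). c \<otimes> y) v"
      then obtain j i j' i' where 1: "u = (?p ((2 * L + 1) * j), ?p i)" "(j, i) \<in> {-m..m} \<times> {-L..L}"
        and 2: "v = (?p ((2 * L + 1) * j'), ?p i')" "(j', i') \<in> {-m..m} \<times> {-L..L}"
        unfolding eq by auto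
      have "?p (?f (j, i)) = ?p (?f (j', i'))" using e unfolding 1 2 mul .
      then have "?f (j, i) = ?f (j', i')" by (rule injD[OF inj])
      then have "(j, i) = (j', i')"
        using inj_onD[OF bij_betw_imp_inj_on[OF f]] 1(2) 2(2) by blast
      then show "u = v" using 1 2 by simp
    qed
    moreover have "\<one> \<in> ?J" using that by (intro image_eqI[of _ _ 0]) auto
    moreover have "?J \<subseteq> carrier G" using x by auto
    ultimately show ?thesis
      unfolding tiled_extension_iff[OF Pc] using bij_betw_imageI[OF _ surj]
      by (intro exI[of _ ?J] conjI)
  qed
  have "tile_system G {P L | L. L \<ge> 0}"
  proof (rule tile_systemI)
    fix A assume "A \<in> {P L | L. L \<ge> 0}"
    then obtain L where L: "L \<ge> 0" "A = P L" by auto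
    have "x [^] (0::int) \<in> P L" using L(1) unfolding mem by simp
    then have "\<one> \<in> A" using L by simp
    then show "finite A \<and> A \<subseteq> carrier G \<and> \<one> \<in> A" using Pc L by (auto simp: P_def)
  next
    fix A K and \<epsilon> :: real
    assume "A \<in> {P L | L. L \<ge> 0}" and K: "finite K" "K \<subseteq> carrier G" and e: "\<epsilon> > 0"
    then obtain L where L: "L \<ge> 0" "A = P L" by auto
    obtain I where I: "finite I" "K = (\<lambda>i::int. x [^] i) ` I"
      using finite_subset_image[OF K(1) K(2)[unfolded gen]] by blast
    define M where "M = Max (insert 0 (abs ` I))"
    have M: "M \<ge> 0" "\<And>i. i \<in> I \<Longrightarrow> \<bar>i\<bar> \<le> M" using I by (auto simp: M_def)
    \<comment> \<open>A shift by \<open>k\<close> with \<open>\<bar>k\<bar> \<le> M\<close> pushes at most \<open>2 M\<close> points out of an interval that has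
      more than \<open>2 m\<close> points.\<close>
    define m where "m = max M \<lceil>M / \<epsilon>\<rceil>"
    have m: "m \<ge> M" "of_int m \<ge> M / \<epsilon>" by (auto simp: m_def) linarith
    define N where "N = L + (2 * L + 1) * m"
    have "m \<le> (2 * L + 1) * m" using mult_right_mono[of 1 "2 * L + 1" m] L(1) M(1) m(1) by simp
    then have N: "N \<ge> m" using L by (simp add: N_def)
    have "K \<subseteq> P N" unfolding I(2)
    proof clarify
      fix i assume "i \<in> I"
      then have "\<bar>i\<bar> \<le> N" using M(2)[of i] m(1) N by linarith
      then show "x [^] i \<in> P N" unfolding mem by auto
    qed
    moreover have "almost_invariant G K \<epsilon> (P N)"
      unfolding almost_invariant_def I(2)
    proof clarify
      fix k assume k: "k \<in> I"
      let ?X = "{y \<in> P N. y \<otimes> x [^] k \<notin> P N}"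
      have "?X \<subseteq> (\<lambda>i::int. x [^] i) ` ({N - M<..N} \<union> {-N..<-N + M})"
      proof
        fix y assume y: "y \<in> ?X"
        then obtain i where i: "y = x [^] i" "i \<in> {-N..N}" by (auto simp: P_def)
        have "x [^] (i + k) \<notin> P N" using y i x by (simp add: int_pow_mult)
        then have "i + k \<notin> {-N..N}" unfolding mem .
        then show "y \<in> (\<lambda>i::int. x [^] i) ` ({N - M<..N} \<union> {-N..<-N + M})"
          using i M(2)[OF k] by (intro image_eqI[of _ _ i]) auto
      qed
      then have "card ?X \<le> card ({N - M<..N} \<union> {-N..<-N + M})"
        by (rule surj_card_le[rotated]) simp
      also have "\<dots> \<le> nat M + nat M" using card_Un_le[of "{N - M<..N}" "{-N..<-N + M}"] by simp
      finally have "real (card ?X) \<le> 2 * of_int M" using M(1) by linarith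
      also have "\<dots> \<le> 2 * (\<epsilon> * of_int m)" using m(2) e by (simp add: field_simps)
      also have "\<dots> \<le> \<epsilon> * (2 * of_int N + 1)"
        using mult_left_mono[of "2 * real_of_int m" "2 * of_int N + 1" \<epsilon>] N e by (simp add: algebra_simps)
      also have "2 * real_of_int N + 1 = real (card (P N))" using N m M by (simp add: cardP)
      finally show "real (card ?X) \<le> \<epsilon> * real (card (P N))" .
    qed
    moreover have "tiled_extension G A (P N)" using ext[OF L(1), of m] M m L by (simp add: N_def)
    moreover have "N \<ge> 0" using N M m by simp
    ultimately show "\<exists>B\<in>{P L | L. L \<ge> 0}. tiled_extension G A B \<and> K \<subseteq> B \<and> almost_invariant G K \<epsilon> B"
      by (intro bexI[of _ "P N"] conjI CollectI exI[of _ N] refl)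
  qed
  then have "extendable_tile G (P 0)" by (auto simp: extendable_tile_def)
  then show ?thesis by (rule extendable_tile_one)
qed

lemma extendable_tile_cyclic:
  assumes x: "x \<in> carrier G" and gen: "carrier G = generate G {x}"
  shows "extendable_tile G {\<one>}"
proof (cases "finite (carrier G)")
  case True
  then show ?thesis using extendable_tile_one extendable_tile_finite_group by blast
next
  case False
  have "carrier (subgroup_generated G {x}) = carrier G"
    using x gen by (simp add: carrier_subgroup_generated Int_absorb1)
  then have "inj (\<lambda>i::int. x [^] i)"
    using False infinite_cyclic_subgroup_int[OF x] by (auto simp: inj_def)
  moreover have "carrier G = range (\<lambda>i::int. x [^] i)"
    using gen generate_pow[OF x] by auto
  ultimately show ?thesis using extendable_tile_infinite_cyclic[OF x] by blast
qed

end

section \<open>Abelian groups\<close>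

context comm_group
begin

text \<open>
  The larger subgroup is a central extension of the smaller one by a cyclic group, and the tile of
  the kernel is preserved by such an extension.
\<close>

lemma extendable_tile_adjoin_generator:
  assumes T: "T \<subseteq> carrier G" and c: "c \<in> carrier G"
    and A: "extendable_tile (G\<lparr>carrier := generate G T\<rparr>) A"
  shows "extendable_tile (G\<lparr>carrier := generate G (insert c T)\<rparr>) A"
proof -
  let ?Y = "insert c T"
  let ?B = "generate G T"
  define C where "C = G\<lparr>carrier := generate G ?Y\<rparr>"
  have subC: "subgroup (generate G ?Y) G" using T c by (intro generate_is_subgroup) auto
  have BC: "?B \<subseteq> generate G ?Y" by (intro mono_generate) auto
  have Cc: "carrier C = generate G ?Y" by (simp add: C_def)
  interpret C: group C unfolding C_def using subC by (rule subgroup_imp_group)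
  have comm: "a \<otimes>\<^bsub>C\<^esub> b = b \<otimes>\<^bsub>C\<^esub> a" if "a \<in> carrier C" "b \<in> carrier C" for a b
  proof -
    have "a \<in> carrier G" "b \<in> carrier G" using that subgroup.subset[OF subC] by (auto simp: C_def)
    then show ?thesis unfolding C_def by (simp add: m_comm)
  qed
  interpret C: comm_group C by (rule C.group_comm_groupI) (rule comm)
  have subB: "subgroup ?B C"
    unfolding C_def using subgroup_incl[OF generate_is_subgroup[OF T] subC BC] .
  then have nB: "?B \<lhd> C" using C.subgroup_imp_normal by blast
  then interpret nB: normal ?B C .
  interpret Q: group "C Mod ?B" using nB.factorgroup_is_group .
  let ?h = "\<lambda>a. ?B #>\<^bsub>C\<^esub> a"
  interpret h: group_hom C "C Mod ?B" ?h
    using nB.r_coset_hom_Mod by unfold_locales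
  have surj: "?h ` carrier C = carrier (C Mod ?B)"
    by (auto simp: FactGroup_def RCOSETS_def)
  have ker: "kernel C (C Mod ?B) ?h = ?B"
  proof -
    have "?h a = ?B \<longleftrightarrow> a \<in> ?B" if "a \<in> carrier C" for a
      using C.coset_join1[OF _ that subB] C.coset_join2[OF that subB] subgroup.subset[OF subB]
      by auto
    then show ?thesis using BC by (auto simp: kernel_def Cc)
  qed
  have gen: "generate C ?Y = carrier C"
    unfolding C_def using generate_consistent[OF _ subC, of ?Y] generate.incl[of _ ?Y G] by auto
  have cC: "c \<in> carrier C" "?Y \<subseteq> carrier C" using generate.incl[of _ ?Y G] by (auto simp: Cc)
  have "carrier (C Mod ?B) = generate (C Mod ?B) (?h ` ?Y)"
    using h.generate_img[OF cC(2)] gen surj by simp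
  also have "\<dots> \<subseteq> generate (C Mod ?B) {?h c}"
  proof (rule Q.generate_subgroup_incl)
    show "subgroup (generate (C Mod ?B) {?h c}) (C Mod ?B)"
      using cC by (intro Q.generate_is_subgroup) auto
    have "?h a = \<one>\<^bsub>C Mod ?B\<^esub>" if "a \<in> T" for a
      using generate.incl[of a T G] that ker by (auto simp: kernel_def)
    then show "?h ` ?Y \<subseteq> generate (C Mod ?B) {?h c}"
      by (auto intro: generate.one generate.incl simp del: one_FactGroup)
  qed
  finally have "carrier (C Mod ?B) = generate (C Mod ?B) {?h c}"
    using Q.generate_incl[of "{?h c}"] cC by auto
  moreover have "?h c \<in> carrier (C Mod ?B)" using h.hom_closed[OF cC(1)] .
  ultimately have "extendable_tile (C Mod ?B) {\<one>\<^bsub>C Mod ?B\<^esub>}"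
    by (rule Q.extendable_tile_cyclic[rotated])
  then have "extendable_tile C A"
    using h.extendable_tile_central_extension[OF surj] comm A ker
    by (auto simp: C_def kernel_def)
  then show ?thesis by (simp add: C_def)
qed

lemma extendable_tile_adjoin_finite:
  assumes "finite Y" "Y \<subseteq> carrier G" "T \<subseteq> carrier G"
    and A: "extendable_tile (G\<lparr>carrier := generate G T\<rparr>) A"
  shows "extendable_tile (G\<lparr>carrier := generate G (Y \<union> T)\<rparr>) A"
  using assms(1,2)
proof (induction Y rule: finite_induct)
  case empty
  then show ?case using A by simp
next
  case (insert c Y)
  then show ?case
    using extendable_tile_adjoin_generator[of "Y \<union> T" c A] assms(3) by auto
qed

text \<open>
  A tile of \<open>generate G T\<close> and a finite set \<open>K\<close> lie together in the finitely generated subgroup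
  \<open>generate G (K \<union> T)\<close>, where the tile is still extendable. So the requirement for a tile
  system only ever has to be met inside a finitely generated subgroup.
\<close>

theorem extendable_tile_abelian: "extendable_tile G {\<one>}"
proof -
  let ?S = "\<lambda>T. G\<lparr>carrier := generate G T\<rparr>"
  define \<F> where "\<F> = {A. \<exists>T. finite T \<and> T \<subseteq> carrier G \<and> extendable_tile (?S T) A}"
  have basic: "finite A \<and> A \<subseteq> carrier G \<and> \<one> \<in> A"
    if "T \<subseteq> carrier G" "extendable_tile (?S T) A" for T A
    using tile_systemD[OF tile_system_extendable_tiles[of "?S T"], of A] that generate_incl[of T]
    by auto
  have "tile_system G \<F>"
  proof (rule tile_systemI)
    show "finite A \<and> A \<subseteq> carrier G \<and> \<one> \<in> A" if "A \<in> \<F>" for A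
      using that basic by (auto simp: \<F>_def)
  next
    fix A K and \<epsilon> :: real
    assume "A \<in> \<F>" and K: "finite K" "K \<subseteq> carrier G" and e: "\<epsilon> > 0"
    then obtain T where T: "finite T" "T \<subseteq> carrier G" "extendable_tile (?S T) A"
      by (auto simp: \<F>_def)
    let ?Y = "K \<union> T"
    have A: "extendable_tile (?S ?Y) A" using extendable_tile_adjoin_finite[OF K T(2,3)] .
    have KY: "K \<subseteq> generate G ?Y" by (auto intro: generate.incl)
    have Yc: "?Y \<subseteq> carrier G" using K T by auto
    have subY: "subgroup (generate G ?Y) G" using Yc by (rule generate_is_subgroup)
    obtain B where B: "extendable_tile (?S ?Y) B" "tiled_extension (?S ?Y) A B" "K \<subseteq> B"
        "almost_invariant G K \<epsilon> B"
      using tile_system_step[OF tile_system_extendable_tiles[of "?S ?Y"], of A K \<epsilon>] A K e KY by auto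
    have AY: "A \<subseteq> generate G ?Y"
      using tile_systemD(2)[OF tile_system_extendable_tiles[of "?S ?Y"], of A] A by auto
    have "tiled_extension G A B"
      using tiled_extension_subgroup[OF subY AY B(2)] subgroup.subset[OF subY] AY
        tiled_extension_iff[of A B] by (metis subset_trans)
    moreover have "B \<in> \<F>" using B(1) K(1) T(1) Yc by (auto simp: \<F>_def)
    ultimately show "\<exists>B\<in>\<F>. tiled_extension G A B \<and> K \<subseteq> B \<and> almost_invariant G K \<epsilon> B"
      using B by blast
  qed
  moreover have "{\<one>} \<in> \<F>"
  proof -
    interpret triv: group "?S {}" by (rule subgroup_imp_group) (simp add: generate_is_subgroup)
    have "extendable_tile (?S {}) {\<one>}"
      using triv.extendable_tile_finite_group by (simp add: generate_empty)
    then show ?thesis by (auto simp: \<F>_def)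
  qed
  ultimately show ?thesis by (auto simp: extendable_tile_def)
qed

end

section \<open>Nilpotent groups\<close>

context group
begin

lemma lower_central_series_subgroup: "subgroup (lower_central_series G n) G"
proof (induction n)
  case 0
  then show ?case by (simp add: subgroup_self)
next
  case (Suc n)
  then show ?case
    using subgroup.subset[OF Suc]
    by (auto simp: commutator_subgroup_def subset_iff intro!: generate_is_subgroup)
qed

lemma commutator_in_lower_central_series:
  assumes "z \<in> lower_central_series G n" "g \<in> carrier G"
  shows "z \<otimes> g \<otimes> inv z \<otimes> inv g \<in> lower_central_series G (Suc n)"
  using assms by (auto simp: commutator_subgroup_def intro!: generate.incl)

end

lemma (in group_hom) lower_central_series_image:
  assumes surj: "h ` carrier G = carrier H"
  shows "lower_central_series H n \<subseteq> h ` lower_central_series G n"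
proof (induction n)
  case 0
  then show ?case using surj by simp
next
  case (Suc n)
  let ?L = "lower_central_series G n"
  have Lc: "?L \<subseteq> carrier G" using subgroup.subset[OF G.lower_central_series_subgroup] .
  let ?C = "\<Union>a\<in>?L. \<Union>b\<in>carrier G. {a \<otimes> b \<otimes> inv a \<otimes> inv b}"
  have Cc: "?C \<subseteq> carrier G" using Lc by auto
  have "x \<otimes>\<^bsub>H\<^esub> y \<otimes>\<^bsub>H\<^esub> inv\<^bsub>H\<^esub> x \<otimes>\<^bsub>H\<^esub> inv\<^bsub>H\<^esub> y \<in> h ` ?C"
    if xy: "x \<in> lower_central_series H n" "y \<in> carrier H" for x y
  proof -
    obtain a where a: "a \<in> ?L" "x = h a" using Suc xy(1) by blast
    obtain b where b: "b \<in> carrier G" "y = h b" using surj xy(2) by blast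
    have "a \<in> carrier G" using a Lc by auto
    then have "x \<otimes>\<^bsub>H\<^esub> y \<otimes>\<^bsub>H\<^esub> inv\<^bsub>H\<^esub> x \<otimes>\<^bsub>H\<^esub> inv\<^bsub>H\<^esub> y = h (a \<otimes> b \<otimes> inv a \<otimes> inv b)"
      using a b by simp
    then show ?thesis using a(1) b(1) by blast
  qed
  then have "lower_central_series H (Suc n) \<subseteq> generate H (h ` ?C)"
    unfolding lower_central_series.simps commutator_subgroup_def
    by (intro mono_generate) blast
  also have "\<dots> = h ` lower_central_series G (Suc n)"
    using generate_img[OF Cc] by (simp add: commutator_subgroup_def)
  finally show ?case .
qed

text \<open>
  The induction over the nilpotency class ranges over groups of one type, whereas the elements of
  \<open>G Mod Z\<close> are sets. Multiplying chosen coset representatives gives an isomorphic quotient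
  inside the original type.
\<close>

lemma (in group) quotient_on_representatives:
  assumes Z: "subgroup Z G"
    and central: "\<And>z g. z \<in> Z \<Longrightarrow> g \<in> carrier G \<Longrightarrow> z \<otimes> g = g \<otimes> z"
  obtains Q :: "('a, 'b) monoid_scheme" and q
  where "group_hom G Q q" "q ` carrier G = carrier Q" "kernel G Q q = Z"
proof -
  have Zc: "Z \<subseteq> carrier G" using subgroup.subset[OF Z] .
  define q where "q a = (SOME x. x \<in> Z #> a)" for a
  have q: "q a \<in> Z #> a" if "a \<in> carrier G" for a
    unfolding q_def using rcos_self[OF that Z] by (rule someI)
  have qz: "\<exists>z\<in>Z. q a = z \<otimes> a" if "a \<in> carrier G" for a
    using q[OF that] by (auto simp: r_coset_def)
  have qc: "q a \<in> carrier G" if "a \<in> carrier G" for a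
    using qz[OF that] that Zc by auto
  have q_eq: "q a = q b \<longleftrightarrow> a \<in> Z #> b" if ab: "a \<in> carrier G" "b \<in> carrier G" for a b
  proof
    assume "q a = q b"
    then have "q a \<in> Z #> a" "q a \<in> Z #> b" using q[OF ab(1)] q[OF ab(2)] by simp_all
    then have "Z #> a = Z #> b"
      using repr_independence[OF _ ab(1) Z] repr_independence[OF _ ab(2) Z] by blast
    then show "a \<in> Z #> b" using rcos_self[OF ab(1) Z] by simp
  next
    assume "a \<in> Z #> b"
    then show "q a = q b" using repr_independence[OF _ ab(2) Z] by (simp add: q_def)
  qed
  define R where "R = G\<lparr>mult := \<lambda>x y. q (x \<otimes> y)\<rparr>"
  have "q \<in> hom G R"
  proof (rule homI)
    fix a b assume ab: "a \<in> carrier G" "b \<in> carrier G"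
    obtain z w where zw: "z \<in> Z" "q a = z \<otimes> a" "w \<in> Z" "q b = w \<otimes> b"
      using qz ab by blast
    have c: "z \<in> carrier G" "w \<in> carrier G" using zw Zc by auto
    have "q a \<otimes> q b = z \<otimes> (a \<otimes> w) \<otimes> b" using zw ab c by (simp add: m_assoc)
    also have "a \<otimes> w = w \<otimes> a" using central[OF zw(3) ab(1)] by (rule sym)
    also have "z \<otimes> (w \<otimes> a) \<otimes> b = (z \<otimes> w) \<otimes> (a \<otimes> b)" using ab c by (simp add: m_assoc)
    finally have "q a \<otimes> q b \<in> Z #> (a \<otimes> b)"
      using subgroup.m_closed[OF Z zw(1,3)] by (auto simp: r_coset_def)
    then have "q (q a \<otimes> q b) = q (a \<otimes> b)" using q_eq[of "q a \<otimes> q b" "a \<otimes> b"] ab qc by auto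
    then show "q (a \<otimes> b) = q a \<otimes>\<^bsub>R\<^esub> q b" by (simp add: R_def)
  qed (use qc in \<open>simp add: R_def\<close>)
  define Q where "Q = R\<lparr>carrier := q ` carrier G, one := q \<one>\<rparr>"
  have "group Q" unfolding Q_def using hom_imp_img_group[OF \<open>q \<in> hom G R\<close>] .
  moreover have "q \<in> hom G Q" using \<open>q \<in> hom G R\<close> by (auto simp: hom_def Q_def)
  ultimately have "group_hom G Q q"
    using group_axioms by (simp add: group_hom_def group_hom_axioms_def)
  moreover have "q ` carrier G = carrier Q" by (simp add: Q_def)
  moreover have "kernel G Q q = Z"
  proof -
    have "Z #> \<one> = Z" using coset_mult_one[OF Zc] .
    then show ?thesis using q_eq[of _ \<one>] Zc by (auto simp: kernel_def Q_def)
  qed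
  ultimately show thesis using that by blast
qed

lemma extendable_tile_nilpotent:
  fixes G :: "('a, 'b) monoid_scheme"
  assumes "group G" "lower_central_series G n = {\<one>\<^bsub>G\<^esub>}"
  shows "extendable_tile G {\<one>\<^bsub>G\<^esub>}"
  using assms
proof (induction n arbitrary: G)
  case 0
  then show ?case using group.extendable_tile_finite_group[of G] by simp
next
  case (Suc n)
  interpret group G by fact
  let ?Z = "lower_central_series G n"
  have Z: "subgroup ?Z G" by (rule lower_central_series_subgroup)
  have Zc: "?Z \<subseteq> carrier G" using subgroup.subset[OF Z] .
  have central: "z \<otimes>\<^bsub>G\<^esub> g = g \<otimes>\<^bsub>G\<^esub> z" if zg: "z \<in> ?Z" "g \<in> carrier G" for z g
  proof -
    have z: "z \<in> carrier G" using zg Zc by auto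
    have "z \<otimes>\<^bsub>G\<^esub> g \<otimes>\<^bsub>G\<^esub> inv\<^bsub>G\<^esub> z \<otimes>\<^bsub>G\<^esub> inv\<^bsub>G\<^esub> g = \<one>\<^bsub>G\<^esub>"
      using commutator_in_lower_central_series[OF zg] Suc.prems(2) by blast
    then have "(z \<otimes>\<^bsub>G\<^esub> g) \<otimes>\<^bsub>G\<^esub> inv\<^bsub>G\<^esub> (g \<otimes>\<^bsub>G\<^esub> z) = \<one>\<^bsub>G\<^esub>"
      using z zg by (simp add: inv_mult_group m_assoc)
    then have "inv\<^bsub>G\<^esub> (inv\<^bsub>G\<^esub> (g \<otimes>\<^bsub>G\<^esub> z)) = z \<otimes>\<^bsub>G\<^esub> g"
      using z zg by (intro inv_equality) auto
    then show ?thesis using z zg by simp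
  qed
  obtain Q :: "('a, 'b) monoid_scheme" and q
    where q: "group_hom G Q q" "q ` carrier G = carrier Q" "kernel G Q q = ?Z"
    using quotient_on_representatives[OF Z central] by blast
  interpret q: group_hom G Q q by fact
  have "lower_central_series Q n \<subseteq> q ` ?Z" using q.lower_central_series_image[OF q(2)] .
  also have "q ` ?Z \<subseteq> {\<one>\<^bsub>Q\<^esub>}" using q(3) by (auto simp: kernel_def)
  finally have "lower_central_series Q n = {\<one>\<^bsub>Q\<^esub>}"
    using subgroup.one_closed[OF q.H.lower_central_series_subgroup[of n]] by auto
  then have Q: "extendable_tile Q {\<one>\<^bsub>Q\<^esub>}" using Suc.IH q.H.group_axioms by blast
  interpret Zg: group "G\<lparr>carrier := ?Z\<rparr>" using Z by (rule subgroup_imp_group)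
  interpret Zg: comm_group "G\<lparr>carrier := ?Z\<rparr>"
    by (rule Zg.group_comm_groupI) (use central Zc in auto)
  have "extendable_tile (G\<lparr>carrier := kernel G Q q\<rparr>) {\<one>\<^bsub>G\<^esub>}"
    using Zg.extendable_tile_abelian by (simp add: q(3))
  from q.extendable_tile_central_extension[OF q(2) _ this Q] show ?case
    using central unfolding q(3) by blast
qed

section \<open>From tile systems to congruent monotileability\<close>

context group
begin

lemma translate_tiling_trans:
  assumes A: "bij_betw (\<lambda>(c, x). c \<otimes> x) (J \<times> A) B" and B: "bij_betw (\<lambda>(c, x). c \<otimes> x) (I \<times> B) C"
    and sub: "A \<subseteq> carrier G" "J \<subseteq> carrier G" "I \<subseteq> carrier G"
  shows "bij_betw (\<lambda>(c, x). c \<otimes> x) ((I <#> J) \<times> A) C"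
proof -
  have BJ: "B = (\<lambda>(c, x). c \<otimes> x) ` (J \<times> A)" and CI: "C = (\<lambda>(c, x). c \<otimes> x) ` (I \<times> B)"
    using A B by (auto simp: bij_betw_def)
  have assoc: "(i \<otimes> j) \<otimes> a = i \<otimes> (j \<otimes> a)" if "i \<in> I" "j \<in> J" "a \<in> A" for i j a
    using that sub by (auto simp: m_assoc subset_iff)
  have "inj_on (\<lambda>(c, x). c \<otimes> x) ((I <#> J) \<times> A)"
  proof (rule inj_onI)
    fix u v assume u: "u \<in> (I <#> J) \<times> A" and v: "v \<in> (I <#> J) \<times> A"
      and eq: "(\<lambda>(c, x). c \<otimes> x) u = (\<lambda>(c, x). c \<otimes> x) v"
    obtain i j a where 1: "u = (i \<otimes> j, a)" "i \<in> I" "j \<in> J" "a \<in> A" using u by (auto simp: set_mult_def)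
    obtain i' j' a' where 2: "v = (i' \<otimes> j', a')" "i' \<in> I" "j' \<in> J" "a' \<in> A"
      using v by (auto simp: set_mult_def)
    have e: "i \<otimes> (j \<otimes> a) = i' \<otimes> (j' \<otimes> a')" using eq 1 2 assoc by simp
    have "j \<otimes> a \<in> B" "j' \<otimes> a' \<in> B" using 1 2 by (auto simp: BJ)
    then have "(i, j \<otimes> a) = (i', j' \<otimes> a')"
      using inj_onD[OF bij_betw_imp_inj_on[OF B], of "(i, j \<otimes> a)" "(i', j' \<otimes> a')"] e 1 2 by auto
    moreover from this have "(j, a) = (j', a')"
      using inj_onD[OF bij_betw_imp_inj_on[OF A], of "(j, a)" "(j', a')"] 1 2 by auto
    ultimately show "u = v" using 1 2 by simp
  qed
  moreover have "(\<lambda>(c, x). c \<otimes> x) ` ((I <#> J) \<times> A) = C"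
  proof
    show "(\<lambda>(c, x). c \<otimes> x) ` ((I <#> J) \<times> A) \<subseteq> C"
    proof clarify
      fix c a assume "c \<in> I <#> J" and a: "a \<in> A"
      then obtain i j where *: "i \<in> I" "j \<in> J" "c = i \<otimes> j" by (auto simp: set_mult_def)
      have "c \<otimes> a = (\<lambda>(c, x). c \<otimes> x) (i, j \<otimes> a)" using * a assoc by simp
      moreover have "j \<otimes> a \<in> B" using * a by (auto simp: BJ)
      ultimately show "c \<otimes> a \<in> C" unfolding CI using *(1) by blast
    qed
    show "C \<subseteq> (\<lambda>(c, x). c \<otimes> x) ` ((I <#> J) \<times> A)"
    proof
      fix x assume "x \<in> C"
      then obtain i j a where *: "i \<in> I" "j \<in> J" "a \<in> A" "x = i \<otimes> (j \<otimes> a)"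
        by (auto simp: CI BJ)
      then have "x = (\<lambda>(c, x). c \<otimes> x) (i \<otimes> j, a)" using assoc by simp
      moreover have "i \<otimes> j \<in> I <#> J" using * by (auto simp: set_mult_def)
      ultimately show "x \<in> (\<lambda>(c, x). c \<otimes> x) ` ((I <#> J) \<times> A)" using *(3) by blast
    qed
  qed
  ultimately show ?thesis by (simp add: bij_betw_def)
qed

text \<open>
  Composing the tilings of consecutive members gives centres \<open>J m\<close> for the tiling of \<open>F (n + m)\<close> by
  \<open>F n\<close>. They increase with \<open>m\<close> because the unit is always a centre, so their union
  inherits unique factorization and reaches everything.
\<close>

lemma exhaustive_congruent_imp_monotile:
  assumes F: "\<And>n. F n \<subseteq> carrier G" "\<And>n. tiled_extension G (F n) (F (Suc n))"
    and exh: "(\<Union>n. F n) = carrier G"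
  shows "\<exists>C. left_tiling G C (F n) (carrier G)"
proof -
  let ?m = "\<lambda>(c, x). c \<otimes> x"
  have "\<exists>J. \<one> \<in> J \<and> J \<subseteq> carrier G \<and> bij_betw ?m (J \<times> F k) (F (Suc k))" for k
    using F(2)[of k] tiled_extension_iff[OF F(1)] by auto
  then obtain j where j: "\<And>k. \<one> \<in> j k" "\<And>k. j k \<subseteq> carrier G"
      "\<And>k. bij_betw ?m (j k \<times> F k) (F (Suc k))"
    by metis
  define J where "J = rec_nat {\<one>} (\<lambda>m J. j (n + m) <#> J)"
  have JS: "J (Suc m) = j (n + m) <#> J m" for m by (simp add: J_def)
  have Jc: "J m \<subseteq> carrier G" for m
    by (induction m) (simp add: J_def, simp add: JS set_mult_closed j(2))
  have bij: "bij_betw ?m (J m \<times> F n) (F (n + m))" for m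
  proof (induction m)
    case 0
    show ?case using F(1)[of n] by (auto simp: J_def bij_betw_def inj_on_def image_iff subset_eq)
  next
    case (Suc m)
    show ?case using translate_tiling_trans[OF Suc j(3) F(1) Jc j(2)] by (simp add: JS)
  qed
  have "J m \<subseteq> J (Suc m)" for m
  proof
    fix x assume "x \<in> J m"
    moreover from this have "x \<in> carrier G" using Jc[of m] by blast
    then have "x = \<one> \<otimes> x" by simp
    ultimately show "x \<in> J (Suc m)" unfolding JS set_mult_def using j(1) by blast
  qed
  then have mono: "J a \<subseteq> J b" if "a \<le> b" for a b using that by (rule lift_Suc_mono_le)
  have "F a \<subseteq> F (Suc a)" for a
  proof
    fix x assume "x \<in> F a"
    moreover from this have "x \<in> carrier G" using F(1)[of a] by blast
    then have "x = ?m (\<one>, x)" by simp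
    ultimately have "x \<in> ?m ` (j a \<times> F a)" using j(1)[of a] by (intro image_eqI[of x ?m "(\<one>, x)"]) auto
    then show "x \<in> F (Suc a)" unfolding bij_betw_imp_surj_on[OF j(3)] .
  qed
  then have monoF: "F a \<subseteq> F b" if "a \<le> b" for a b using that by (rule lift_Suc_mono_le)
  let ?C = "\<Union>m. J m"
  have "inj_on ?m (?C \<times> F n)"
  proof (rule inj_onI)
    fix u v assume u: "u \<in> ?C \<times> F n" and v: "v \<in> ?C \<times> F n" and eq: "?m u = ?m v"
    obtain a b where "fst u \<in> J a" "fst v \<in> J b" using u v by auto
    then have "u \<in> J (max a b) \<times> F n" "v \<in> J (max a b) \<times> F n"
      using mono[of a "max a b"] mono[of b "max a b"] u v by (auto simp: mem_Times_iff)
    then show "u = v" by (rule inj_onD[OF bij_betw_imp_inj_on[OF bij] eq])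
  qed
  moreover have "?m ` (?C \<times> F n) = carrier G"
  proof -
    have "?m ` (?C \<times> F n) = (\<Union>m. ?m ` (J m \<times> F n))" by blast
    also have "\<dots> = (\<Union>m. F (n + m))" using bij_betw_imp_surj_on[OF bij] by simp
    also have "\<dots> = (\<Union>m. F m)"
    proof
      show "(\<Union>m. F m) \<subseteq> (\<Union>m. F (n + m))" using monoF[OF le_add2] by blast
    qed blast
    finally show ?thesis using exh by simp
  qed
  moreover have "?C \<subseteq> carrier G" using Jc by auto
  ultimately have "left_tiling G ?C (F n) (carrier G)"
    unfolding left_tiling_iff_bij_betw[OF F(1)] by (intro conjI bij_betw_imageI)
  then show ?thesis by (rule exI)
qed

lemma card_right_translate_diff:
  assumes "A \<subseteq> carrier G" "g \<in> carrier G"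
  shows "card ((A #> g) - A) = card {x \<in> A. x \<otimes> g \<notin> A}"
proof -
  have "(A #> g) - A = (\<lambda>x. x \<otimes> g) ` {x \<in> A. x \<otimes> g \<notin> A}" by (auto simp: r_coset_def)
  moreover have "inj_on (\<lambda>x. x \<otimes> g) {x \<in> A. x \<otimes> g \<notin> A}"
    using assms by (auto simp: inj_on_def subset_iff)
  ultimately show ?thesis by (simp add: card_image)
qed

text \<open>
  Step \<open>n\<close> of the choice handles the first elements of an enumeration up to index \<open>n\<close>, with
  precision \<open>1 / (n + 1)\<close>. Every element is treated from some step on, which gives both exhaustion
  and the Folner condition.
\<close>

lemma congruent_monotileable_if_extendable_tile:
  assumes count: "countable (carrier G)" and ext: "extendable_tile G {\<one>}"
  shows "congruent_monotileable G"
proof -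
  obtain \<F> where S: "tile_system G \<F>" "{\<one>} \<in> \<F>" using ext by (auto simp: extendable_tile_def)
  define e where "e = from_nat_into (carrier G)"
  have e: "range e = carrier G"
    unfolding e_def by (rule range_from_nat_into[OF _ count]) (use one_closed in blast)
  define K where "K n = e ` {..n}" for n :: nat
  have K: "finite (K n)" "K n \<subseteq> carrier G" for n using e by (auto simp: K_def)
  have "\<exists>F. \<forall>n. F n \<in> \<F> \<and> (tiled_extension G (F n) (F (Suc n)) \<and> K n \<subseteq> F (Suc n) \<and>
      almost_invariant G (K n) (1 / real (Suc n)) (F (Suc n)))"
  proof (rule dependent_nat_choice)
    show "\<exists>A. A \<in> \<F>" using S by blast
    show "\<exists>B. B \<in> \<F> \<and> tiled_extension G A B \<and> K n \<subseteq> B \<and> almost_invariant G (K n) (1 / real (Suc n)) B"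
      if "A \<in> \<F>" for A n
    proof -
      have "1 / real (Suc n) > 0" by simp
      from tile_system_step[OF S(1) that K(1)[of n] K(2)[of n] this]
      obtain B where "B \<in> \<F>" "tiled_extension G A B" "K n \<subseteq> B"
          "almost_invariant G (K n) (1 / real (Suc n)) B" .
      then show ?thesis by (intro exI[of _ B] conjI)
    qed
  qed
  then obtain F where "\<forall>n. F n \<in> \<F> \<and> (tiled_extension G (F n) (F (Suc n)) \<and> K n \<subseteq> F (Suc n) \<and>
      almost_invariant G (K n) (1 / real (Suc n)) (F (Suc n)))" ..
  then have F: "\<And>n. F n \<in> \<F>" "\<And>n. tiled_extension G (F n) (F (Suc n))"
      "\<And>n. K n \<subseteq> F (Suc n)" "\<And>n. almost_invariant G (K n) (1 / real (Suc n)) (F (Suc n))"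
    by simp_all
  have Fb: "finite (F n)" "F n \<subseteq> carrier G" "\<one> \<in> F n" for n
    by (rule tile_systemD[OF S(1) F(1)])+
  have exh: "(\<Union>n. F n) = carrier G"
  proof
    show "carrier G \<subseteq> (\<Union>n. F n)"
    proof
      fix x assume "x \<in> carrier G"
      then obtain i where "x = e i" using e by auto
      then have "x \<in> F (Suc i)" using F(3)[of i] by (auto simp: K_def)
      then show "x \<in> (\<Union>n. F n)" by blast
    qed
  qed (use Fb in auto)
  have "(\<lambda>n. real (card ((F n #> g) - F n)) / real (card (F n))) \<longlonglongrightarrow> 0"
    if g: "g \<in> carrier G" for g
  proof -
    obtain i where i: "g = e i" using e g by auto
    have le: "real (card ((F n #> g) - F n)) / real (card (F n)) \<le> 1 / real n" if n: "n \<ge> Suc i" for n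
    proof -
      obtain m where m: "n = Suc m" "m \<ge> i" using n by (cases n) auto
      have "g \<in> K m" using i m by (auto simp: K_def)
      then have "real (card ((F n #> g) - F n)) \<le> 1 / real n * real (card (F n))"
        using F(4)[of m] m(1) by (simp add: almost_invariant_def card_right_translate_diff[OF Fb(2) g])
      moreover have "card (F n) > 0" using Fb[of n] by (auto simp: card_gt_0_iff)
      ultimately show ?thesis by (simp add: pos_divide_le_eq)
    qed
    show ?thesis
    proof (rule tendsto_sandwich[OF _ _ tendsto_const lim_1_over_n])
      show "\<forall>\<^sub>F n in sequentially. real (card ((F n #> g) - F n)) / real (card (F n)) \<le> 1 / real n"
        using le by (auto simp: eventually_sequentially)
    qed simp
  qed
  then have "right_Folner_sequence G F"
    unfolding right_Folner_sequence_def using Fb by (metis empty_iff)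
  moreover have "congruent_sequence G F"
    using Fb F(2) by (auto simp: congruent_sequence_def tiled_extension_def)
  moreover have "left_monotile G (F n)" for n
    using exhaustive_congruent_imp_monotile[of F n] Fb F(2) exh by (simp add: left_monotile_def)
  ultimately show ?thesis using exh by (auto simp: congruent_monotileable_def)
qed

end

theorem theorem1:
  fixes G :: "('a, 'b) monoid_scheme"
  assumes "group G" and "countable (carrier G)" and "virtually_nilpotent G"
  shows "congruent_monotileable G"
proof -
  interpret group G by fact
  obtain H where H: "subgroup H G" "finite (rcosets\<^bsub>G\<^esub> H)" "nilpotent_group (G\<lparr>carrier := H\<rparr>)"
    using assms(3) by (auto simp: virtually_nilpotent_def)
  then obtain n where "group (G\<lparr>carrier := H\<rparr>)"
      "lower_central_series (G\<lparr>carrier := H\<rparr>) n = {\<one>\<^bsub>G\<lparr>carrier := H\<rparr>\<^esub>}"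
    by (auto simp: nilpotent_group_def)
  then have "extendable_tile (G\<lparr>carrier := H\<rparr>) {\<one>\<^bsub>G\<lparr>carrier := H\<rparr>\<^esub>}"
    by (rule extendable_tile_nilpotent)
  then have "extendable_tile G {\<one>\<^bsub>G\<^esub>}"
    using extendable_tile_finite_index[OF H(1,2)] by blast
  then show ?thesis using congruent_monotileable_if_extendable_tile assms(2) by blast
qed

end
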